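(* Let $n\ge 2$. Every complete $(3,n)$-net in $\mathbb{P}^2$ is projectively equivalent to the arrangement with defining polynomial $[x^n-y^n][x^n-z^n][y^n-z^n]$, where the three brackets give the three blocks.
   Context: All lines lie in the complex projective plane $\mathbb{P}^2$. A pencil of plane curves of degree $d$ is a line in the projective space of homogeneous polynomials of degree $d$ in $\mathbb{C}[x,y,z]$; its members are called fibers. The pencil has no fixed component if its fibers have no common component; then its base $\mathcal{X}$, the common intersection of any two distinct fibers, is a finite set. A fiber is completely reducible if it has the form $\prod_i \alpha_i^{m_i}$ with $\alpha_i$ pairwise non-proportional linear forms and $m_i\in\mathbb{Z}_{>0}$. A $(k,d)$-multinet ($k\ge 3$) is the multi-arrangement $\mathcal{A}$ of lines given by $k$ distinct completely reducible fibers of a pencil of degree $d$ without fixed components. It is partitioned into blocks $\mathcal{A}_1,\dots,\mathcal{A}_k$ (the sets of lines in the $k$ fibers), and each line $\ell$ carries the multiplicity $m(\ell)$ of its linear form in its fiber. The following connectivity condition is required: for any two lines $\ell,\ell'$ of the same block there is a sequence of lines of that block $\ell=\ell_0,\ell_1,\dots,\ell_r=\ell'$ with $\ell_{i-1}\cap\ell_i\notin\mathcal{X}$ for $1\le i\le r$. The base $\mathcal{X}$ of the pencil is the base of the multinet; it is the set of intersection points of lines from different blocks. For $p\in\mathcal{X}$ the number $n_p=\sum_{\ell\in\mathcal{A}_i,\,p\in\ell}m(\ell)$ does not depend on $i$ and is called the multiplicity of $p$. The multinet is a net if $|\mathcal{X}|=d^2$ (then all $m(\ell)=1$ and all $n_p=1$).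 Let $|\mathcal{A}|$ be the number of distinct lines of $\mathcal{A}$, let $\overline{\mathcal{X}}$ be the set of intersection points of lines of $\mathcal{A}$ that are not in $\mathcal{X}$, and for $p\in\overline{\mathcal{X}}$ let $m_p$ be the number of distinct lines of $\mathcal{A}$ through $p$. A $(k,d)$-multinet with $d\ge 2$ is complete if $$3+|\mathcal{X}|=(2-k)\Big[3d-d^2+\sum_{p\in\mathcal{X}}(n_p^2-n_p)\Big]+2|\mathcal{A}|-\sum_{p\in\overline{\mathcal{X}}}(m_p-1).$$ For $k=3$ this is equivalent to $\sum_{p\in\overline{\mathcal{X}}}(m_p-1)=2|\mathcal{A}|-|\mathcal{X}|-3(d+1)+\sum_{p\in\mathcal{X}}n_p$. Projective equivalence means that some projective transformation of $\mathbb{P}^2$ carries the lines of one arrangement onto those of the other, matching multiplicities and blocks (up to permutation of blocks). *)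

theory Defs
  imports "HOL-Analysis.Analysis" "HOL-Library.Poly_Mapping"
begin

section \<open>The complex projective plane\<close>

typedef cp2 = "{U :: (complex^3) set. vec.subspace U \<and> vec.dim U = 1}"
proof
  show "vec.span {1 :: complex^3} \<in> {U. vec.subspace U \<and> vec.dim U = 1}"
    by (simp add: vec.subspace_span)
qed

definition line_of :: "complex^3 \<Rightarrow> cp2 set" where
  "line_of a = {p. \<forall>v \<in> Rep_cp2 p. (\<Sum>i\<in>UNIV. a $ i * v $ i) = 0}"

text \<open>Only meaningful for an invertible matrix, which maps 1-dimensional subspaces to
  1-dimensional subspaces.\<close>

definition proj_map :: "complex^3^3 \<Rightarrow> cp2 \<Rightarrow> cp2" where
  "proj_map T p = Abs_cp2 ((\<lambda>v. T *v v) ` Rep_cp2 p)"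

section \<open>Polynomials in three variables\<close>

text \<open>A monomial is its exponent vector; the type \<open>3\<close> has exactly the elements \<open>1\<close>, \<open>2\<close>, \<open>3\<close>
  (the last one equals \<open>0\<close>), which index \<open>x\<close>, \<open>y\<close>, \<open>z\<close>. Addition and multiplication (hence also
  divisibility, powers and products) are those of \<^theory>\<open>HOL-Library.Poly_Mapping\<close>.\<close>

type_synonym poly3 = "(3 \<Rightarrow>\<^sub>0 nat) \<Rightarrow>\<^sub>0 complex"

definition const3 :: "complex \<Rightarrow> poly3" where
  "const3 c = Poly_Mapping.single 0 c"

definition var3 :: "3 \<Rightarrow> poly3" where
  "var3 i = Poly_Mapping.single (Poly_Mapping.single i 1) 1"

definition linear_form :: "complex^3 \<Rightarrow> poly3" where
  "linear_form a = (\<Sum>i\<in>UNIV. const3 (a $ i) * var3 i)"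

definition homogeneous3 :: "nat \<Rightarrow> poly3 \<Rightarrow> bool" where
  "homogeneous3 d F \<longleftrightarrow>
     (\<forall>mon \<in> Poly_Mapping.keys F. (\<Sum>i\<in>UNIV. Poly_Mapping.lookup mon i) = d)"

definition eval3 :: "poly3 \<Rightarrow> complex^3 \<Rightarrow> complex" where
  "eval3 F v = (\<Sum>mon \<in> Poly_Mapping.keys F.
     Poly_Mapping.lookup F mon * (\<Prod>i\<in>UNIV. v $ i ^ Poly_Mapping.lookup mon i))"

definition vanishes_at :: "poly3 \<Rightarrow> cp2 \<Rightarrow> bool" where
  "vanishes_at F p \<longleftrightarrow> (\<forall>v \<in> Rep_cp2 p. eval3 F v = 0)"

section \<open>Pencils\<close>

text \<open>A line in the projective space of forms of degree \<open>d\<close> is given by the corresponding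
  2-dimensional space of forms; fibers are its nonzero elements, up to a scalar.\<close>

definition pencil :: "nat \<Rightarrow> poly3 set \<Rightarrow> bool" where
  "pencil d P \<longleftrightarrow> (\<exists>F G. homogeneous3 d F \<and> homogeneous3 d G \<and>
     (\<forall>a b. const3 a * F + const3 b * G = 0 \<longrightarrow> a = 0 \<and> b = 0) \<and>
     P = {const3 a * F + const3 b * G | a b. True})"

definition same_fiber :: "poly3 \<Rightarrow> poly3 \<Rightarrow> bool" where
  "same_fiber F G \<longleftrightarrow> (\<exists>c. c \<noteq> 0 \<and> F = const3 c * G)"

definition no_fixed_component :: "poly3 set \<Rightarrow> bool" where
  "no_fixed_component P \<longleftrightarrow> \<not> (\<exists>e h. e > 0 \<and> homogeneous3 e h \<and> (\<forall>F\<in>P. h dvd F))"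

definition pencil_base :: "poly3 set \<Rightarrow> cp2 set" where
  "pencil_base P = {p. \<forall>F\<in>P. vanishes_at F p}"

text \<open>\<open>F\<close> is a product of powers of pairwise non-proportional linear forms; \<open>L\<close> is the set of
  their zero lines and \<open>m\<close> gives the exponents. Non-proportionality is implicit in indexing the
  forms by their zero lines. \<open>L\<close>, and \<open>m\<close> on \<open>L\<close>, are determined by \<open>F\<close>.\<close>

definition completely_reducible :: "poly3 \<Rightarrow> cp2 set set \<Rightarrow> (cp2 set \<Rightarrow> nat) \<Rightarrow> bool" where
  "completely_reducible F L m \<longleftrightarrow> finite L \<and>
     (\<exists>\<alpha>. (\<forall>l\<in>L. \<alpha> l \<noteq> 0 \<and> line_of (\<alpha> l) = l \<and> m l > 0) \<and>
          F = (\<Prod>l\<in>L. linear_form (\<alpha> l) ^ m l))"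

section \<open>Multinets\<close>

text \<open>A multi-arrangement with \<open>k\<close> blocks is given by \<open>B\<close>, whose values \<open>B i\<close> for \<open>i < k\<close> are the
  blocks, and by the multiplicity function \<open>m\<close> on lines. One function \<open>m\<close> suffices, since distinct
  fibers of a pencil without fixed components have no line in common.\<close>

definition all_lines :: "nat \<Rightarrow> (nat \<Rightarrow> cp2 set set) \<Rightarrow> cp2 set set" where
  "all_lines k B = (\<Union>i<k. B i)"

definition block_connected :: "cp2 set \<Rightarrow> cp2 set set \<Rightarrow> bool" where
  "block_connected X L \<longleftrightarrow>
     (\<forall>l\<in>L. \<forall>l'\<in>L. (l, l') \<in> {(s, t). s \<in> L \<and> t \<in> L \<and> s \<inter> t \<inter> X = {}}\<^sup>*)"

definition multinet ::
  "nat \<Rightarrow> nat \<Rightarrow> poly3 set \<Rightarrow> (nat \<Rightarrow> cp2 set set) \<Rightarrow> (cp2 set \<Rightarrow> nat) \<Rightarrow> bool" where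
  "multinet k d P B m \<longleftrightarrow>
     k \<ge> 3 \<and> pencil d P \<and> no_fixed_component P \<and>
     (\<exists>Q. (\<forall>i<k. Q i \<in> P \<and> completely_reducible (Q i) (B i) m) \<and>
          (\<forall>i<k. \<forall>j<k. i \<noteq> j \<longrightarrow> \<not> same_fiber (Q i) (Q j))) \<and>
     (\<forall>i<k. block_connected (pencil_base P) (B i))"

definition net ::
  "nat \<Rightarrow> nat \<Rightarrow> poly3 set \<Rightarrow> (nat \<Rightarrow> cp2 set set) \<Rightarrow> (cp2 set \<Rightarrow> nat) \<Rightarrow> bool" where
  "net k d P B m \<longleftrightarrow> multinet k d P B m \<and> card (pencil_base P) = d\<^sup>2"

text \<open>The multiplicity \<open>n\<^sub>p\<close> of a base point, computed in the block \<open>B 0\<close>; in a multinet every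
  block gives the same number.\<close>

definition base_mult :: "(nat \<Rightarrow> cp2 set set) \<Rightarrow> (cp2 set \<Rightarrow> nat) \<Rightarrow> cp2 \<Rightarrow> nat" where
  "base_mult B m p = (\<Sum>l | l \<in> B 0 \<and> p \<in> l. m l)"

definition nonbase_points :: "nat \<Rightarrow> poly3 set \<Rightarrow> (nat \<Rightarrow> cp2 set set) \<Rightarrow> cp2 set" where
  "nonbase_points k P B =
     {p. \<exists>l \<in> all_lines k B. \<exists>l' \<in> all_lines k B. l \<noteq> l' \<and> p \<in> l \<inter> l'} - pencil_base P"

definition line_count :: "nat \<Rightarrow> (nat \<Rightarrow> cp2 set set) \<Rightarrow> cp2 \<Rightarrow> nat" where
  "line_count k B p = card {l \<in> all_lines k B. p \<in> l}"

definition complete_multinet ::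
  "nat \<Rightarrow> nat \<Rightarrow> poly3 set \<Rightarrow> (nat \<Rightarrow> cp2 set set) \<Rightarrow> (cp2 set \<Rightarrow> nat) \<Rightarrow> bool" where
  "complete_multinet k d P B m \<longleftrightarrow> multinet k d P B m \<and> d \<ge> 2 \<and>
     3 + int (card (pencil_base P)) =
       (2 - int k) * (3 * int d - (int d)\<^sup>2 +
          (\<Sum>p\<in>pencil_base P. (int (base_mult B m p))\<^sup>2 - int (base_mult B m p)))
       + 2 * int (card (all_lines k B))
       - (\<Sum>p\<in>nonbase_points k P B. int (line_count k B p) - 1)"

section \<open>Projective equivalence and the target arrangement\<close>

definition proj_equivalent ::
  "nat \<Rightarrow> (nat \<Rightarrow> cp2 set set) \<Rightarrow> (cp2 set \<Rightarrow> nat) \<Rightarrow> (nat \<Rightarrow> cp2 set set) \<Rightarrow> (cp2 set \<Rightarrow> nat) \<Rightarrow> bool"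
  where
  "proj_equivalent k B m B' m' \<longleftrightarrow>
     (\<exists>T :: complex^3^3. invertible T \<and>
       (\<exists>\<sigma>. bij_betw \<sigma> {..<k} {..<k} \<and>
         (\<forall>i<k. B' (\<sigma> i) = (\<lambda>l. proj_map T ` l) ` B i \<and>
                (\<forall>l \<in> B i. m' (proj_map T ` l) = m l))))"

text \<open>The multi-arrangement with defining polynomial \<open>q 0 * \<dots> * q (k - 1)\<close>, the factors \<open>q i\<close>
  giving the blocks.\<close>

definition defined_by ::
  "nat \<Rightarrow> (nat \<Rightarrow> poly3) \<Rightarrow> (nat \<Rightarrow> cp2 set set) \<Rightarrow> (cp2 set \<Rightarrow> nat) \<Rightarrow> bool" where
  "defined_by k q B m \<longleftrightarrow> (\<forall>i<k. completely_reducible (q i) (B i) m)"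

definition fermat_factors :: "nat \<Rightarrow> nat \<Rightarrow> poly3" where
  "fermat_factors n i =
     [var3 1 ^ n - var3 2 ^ n, var3 1 ^ n - var3 3 ^ n, var3 2 ^ n - var3 3 ^ n] ! i"

end

theory Submission
  imports Defs "HOL-Computational_Algebra.Polynomial"
begin

text \<open>
  In a \<open>(3,n)\<close>-net each block consists of \<open>n\<close> simple lines, and every base point lies on exactly one
  line of each block. Completeness then says that the numbers \<open>m\<^sub>p - 1\<close> add up to \<open>3(n - 1)\<close>. Counting
  along one line of a block shows that each block contributes at least \<open>n - 1\<close>, with equality only if
  the block is concurrent; hence every block is a pencil with some centre \<open>p\<^sub>i\<close>.

  If the three centres are collinear, put their line at infinity: the lines of the blocks become
  finite sets \<open>A\<close>, \<open>B\<close>, \<open>C\<close> of \<open>n\<close> complex numbers with \<open>y b - x a \<in> C\<close> for all \<open>a \<in> A\<close>, \<open>b \<in> B\<close>, and summing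
  over \<open>b\<close> determines \<open>a\<close>, so \<open>n = 1\<close>. Otherwise take the centres as coordinate points; the blocks
  \<open>x = r y\<close>, \<open>x = s z\<close>, \<open>y = t z\<close> satisfy \<open>s / r \<in> T\<close>, and taking products over \<open>s\<close> or over \<open>r\<close> shows that, after
  scaling to \<open>1 \<in> R\<close> and \<open>1 \<in> S\<close>, all three sets are the \<open>n\<close>-th roots of unity.
\<close>

section \<open>Evaluation and homogeneity of ternary polynomials\<close>

lemma eval3_superset:
  assumes "finite S" "Poly_Mapping.keys F \<subseteq> S"
  shows "eval3 F v = (\<Sum>mon\<in>S. Poly_Mapping.lookup F mon * (\<Prod>i\<in>UNIV. v $ i ^ Poly_Mapping.lookup mon i))"
  unfolding eval3_def using assms
  by (intro sum.mono_neutral_left) (auto simp: in_keys_iff)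

lemma eval3_zero [simp]: "eval3 0 v = 0"
  by (simp add: eval3_def)

lemma eval3_add: "eval3 (F + G) v = eval3 F v + eval3 G v"
  unfolding eval3_def
  by (rule setsum_keys_plus_distrib) (auto simp: algebra_simps)

lemma eval3_sum: "eval3 (sum f S) v = (\<Sum>i\<in>S. eval3 (f i) v)"
  by (induction S rule: infinite_finite_induct) (auto simp: eval3_add)

lemma eval3_single:
  "eval3 (Poly_Mapping.single mon c) v = c * (\<Prod>i\<in>UNIV. v $ i ^ Poly_Mapping.lookup mon i)"
  by (subst eval3_superset[of "{mon}"]) auto

lemma sum_monomials:
  "(\<Sum>mon\<in>Poly_Mapping.keys F. Poly_Mapping.single mon (Poly_Mapping.lookup F mon)) = F"
proof (rule poly_mapping_eqI)
  fix k
  show "Poly_Mapping.lookup (\<Sum>mon\<in>Poly_Mapping.keys F. Poly_Mapping.single mon (Poly_Mapping.lookup F mon)) k =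
        Poly_Mapping.lookup F k"
    by (cases "k \<in> Poly_Mapping.keys F")
       (auto simp: lookup_sum lookup_single when_def in_keys_iff sum.delta' sum.neutral)
qed

text \<open>Both sides are bilinear, so expanding \<open>F\<close> and \<open>G\<close> into
  monomials reduces the claim to single terms, whose exponents add.\<close>

lemma eval3_mult: "eval3 (F * G) v = eval3 F v * eval3 G v"
proof -
  let ?m = "\<lambda>F mon. Poly_Mapping.single mon (Poly_Mapping.lookup F mon) :: poly3"
  have s: "eval3 (Poly_Mapping.single a x * Poly_Mapping.single b y) v =
      eval3 (Poly_Mapping.single a x) v * eval3 (Poly_Mapping.single b y) v" for a b x y
    by (simp add: mult_single eval3_single lookup_add power_add prod.distrib)
  have "eval3 (F * G) v = eval3 (sum (?m F) (Poly_Mapping.keys F) * sum (?m G) (Poly_Mapping.keys G)) v"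
    by (simp only: sum_monomials)
  also have "\<dots> = eval3 (sum (?m F) (Poly_Mapping.keys F)) v * eval3 (sum (?m G) (Poly_Mapping.keys G)) v"
    by (simp add: sum_product eval3_sum s)
  finally show ?thesis
    by (simp only: sum_monomials)
qed

lemma eval3_const3 [simp]: "eval3 (const3 c) v = c"
  by (simp add: const3_def eval3_single)

lemma eval3_var3 [simp]: "eval3 (var3 i) v = v $ i"
proof -
  have "(\<Prod>j\<in>UNIV. v $ j ^ Poly_Mapping.lookup (Poly_Mapping.single i 1) j) =
      (\<Prod>j\<in>UNIV. if j = i then v $ j else 1)"
    by (intro prod.cong) (auto simp: lookup_single when_def)
  then show ?thesis
    by (simp add: var3_def eval3_single)
qed

lemma eval3_power: "eval3 (F ^ k) v = eval3 F v ^ k"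
  using eval3_const3[of 1 v] by (induction k) (auto simp: eval3_mult const3_def)

lemma eval3_prod: "eval3 (prod f S) v = (\<Prod>i\<in>S. eval3 (f i) v)"
  using eval3_const3[of 1 v]
  by (induction S rule: infinite_finite_induct) (auto simp: eval3_mult const3_def)

lemma eval3_linear_form [simp]: "eval3 (linear_form a) v = (\<Sum>i\<in>UNIV. a $ i * v $ i)"
  by (simp add: linear_form_def eval3_sum eval3_mult)

lemma const3_mult: "const3 (a * b) = const3 a * const3 b"
  by (simp add: const3_def mult_single)

lemma const3_add: "const3 (a + b) = const3 a + const3 b"
  by (simp add: const3_def single_add)

lemma const3_uminus: "const3 (- a) = - const3 a"
  by (simp add: const3_def single_uminus)

lemma const3_0 [simp]: "const3 0 = 0"
  by (simp add: const3_def)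

lemma const3_1 [simp]: "const3 1 = 1"
  by (simp add: const3_def)

lemma homogeneous3_mult:
  assumes "homogeneous3 d F" "homogeneous3 e G"
  shows "homogeneous3 (d + e) (F * G)"
  using assms keys_mult[of F G] unfolding homogeneous3_def
  by (fastforce simp: lookup_add sum.distrib)

lemma homogeneous3_const3 [simp]: "homogeneous3 0 (const3 c)"
  by (auto simp: homogeneous3_def const3_def)

lemma homogeneous3_power: "homogeneous3 d F \<Longrightarrow> homogeneous3 (k * d) (F ^ k)"
  using homogeneous3_const3[of 1] by (induction k) (auto intro: homogeneous3_mult)

lemma homogeneous3_prod:
  "(\<And>i. i \<in> S \<Longrightarrow> homogeneous3 (d i) (f i)) \<Longrightarrow> homogeneous3 (sum d S) (prod f S)"
  using homogeneous3_const3[of 1]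
  by (induction S rule: infinite_finite_induct) (auto intro: homogeneous3_mult)

lemma homogeneous3_add:
  assumes "homogeneous3 d F" "homogeneous3 d G"
  shows "homogeneous3 d (F + G)"
  using assms keys_add[of F G] unfolding homogeneous3_def by fastforce

lemma homogeneous3_sum:
  "(\<And>i. i \<in> S \<Longrightarrow> homogeneous3 d (f i)) \<Longrightarrow> homogeneous3 d (sum f S)"
  by (induction S rule: infinite_finite_induct)
     (auto intro: homogeneous3_add simp: homogeneous3_def[of _ 0])

lemma homogeneous3_var3: "homogeneous3 1 (var3 i)"
  by (simp add: homogeneous3_def var3_def lookup_single when_def)

lemma homogeneous3_linear_form: "homogeneous3 1 (linear_form a)"
  unfolding linear_form_def
  using homogeneous3_mult[OF homogeneous3_const3 homogeneous3_var3] by (auto intro: homogeneous3_sum)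

text \<open>Used to compare the degree \<open>n\<close> of the pencil with the sum of the
  multiplicities of the lines in a fiber.\<close>

lemma homogeneous3_degree_unique:
  assumes "homogeneous3 d F" "homogeneous3 e F" "F \<noteq> 0"
  shows "d = e"
proof -
  obtain mon where "mon \<in> Poly_Mapping.keys F"
    using assms(3) by (metis keys_eq_empty ex_in_conv)
  then show ?thesis
    using assms(1,2) by (auto simp: homogeneous3_def)
qed

lemma linear_form_nonzero: "a \<noteq> 0 \<Longrightarrow> linear_form a \<noteq> 0"
proof
  assume "a \<noteq> 0" "linear_form a = 0"
  then obtain i where i: "a $ i \<noteq> 0" by (auto simp: vec_eq_iff)
  have "eval3 (linear_form a) (axis i 1) = a $ i"
    by (simp add: axis_def if_distrib[of "\<lambda>x. _ * x"] cong: if_cong)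
  with i \<open>linear_form a = 0\<close> show False by simp
qed

section \<open>Points and lines\<close>

text \<open>The bilinear pairing of a linear form with a vector; no complex conjugation
  enters.\<close>

definition dot :: "complex^3 \<Rightarrow> complex^3 \<Rightarrow> complex" where
  "dot a v = a$1 * v$1 + a$2 * v$2 + a$3 * v$3"

text \<open>The point with homogeneous coordinates \<open>v\<close>. It is meaningful only for
  \<open>v \<noteq> 0\<close>, which the lemmas on \<open>pt\<close> therefore assume.\<close>

definition pt :: "complex^3 \<Rightarrow> cp2" where
  "pt v = Abs_cp2 (vec.span {v})"

lemma dot_sum: "(\<Sum>i\<in>UNIV. a $ i * v $ i) = dot a v"
  by (simp add: dot_def sum_3)

lemma dot_scale [simp]: "dot (c *s a) v = c * dot a v" "dot a (c *s v) = c * dot a v"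
  by (auto simp: dot_def algebra_simps)

lemma dot_add [simp]: "dot a (u + v) = dot a u + dot a v"
  by (auto simp: dot_def algebra_simps)

lemma vec3_eq_iff: "(u :: complex^3) = v \<longleftrightarrow> u$1 = v$1 \<and> u$2 = v$2 \<and> u$3 = v$3"
  by (simp add: vec_eq_iff forall_3)

lemma Rep_pt:
  assumes "v \<noteq> 0"
  shows "Rep_cp2 (pt v) = range (\<lambda>k. k *s v)"
proof -
  have "vec.dim (vec.span {v}) = card {v}"
    using assms by (intro vec.dim_span_eq_card_independent) (simp add: vec.independent_insert)
  then show ?thesis
    unfolding pt_def by (subst Abs_cp2_inverse) (auto simp: vec.span_singleton[symmetric] vec.subspace_span)
qed

lemma cp2_cases:
  obtains v where "v \<noteq> 0" "p = pt v"
proof -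
  have U: "vec.subspace (Rep_cp2 p)" "vec.dim (Rep_cp2 p) = 1"
    using Rep_cp2[of p] by auto
  obtain S where S: "S \<subseteq> Rep_cp2 p" "vec.independent S" "Rep_cp2 p \<subseteq> vec.span S" "card S = 1"
    using vec.basis_exists[of "Rep_cp2 p"] U(2) by metis
  then obtain v where v: "S = {v}"
    by (auto simp: card_1_singleton_iff)
  have "v \<noteq> 0" using S(2) v vec.dependent_zero[of S] by auto
  moreover have "Rep_cp2 p = vec.span {v}"
    using S v U(1) vec.span_minimal[of S "Rep_cp2 p"] by auto
  then have "p = pt v"
    unfolding pt_def using Rep_cp2_inverse[of p] by simp
  ultimately show thesis using that by blast
qed

lemma pt_in_line_of [simp]:
  assumes "v \<noteq> 0"
  shows "pt v \<in> line_of a \<longleftrightarrow> dot a v = 0"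
proof -
  have "pt v \<in> line_of a \<longleftrightarrow> (\<forall>k. k * dot a v = 0)"
    using assms by (simp add: line_of_def Rep_pt dot_sum)
  then show ?thesis by (auto dest: spec[of _ 1])
qed

lemma pt_eq_iff:
  assumes "u \<noteq> 0" "v \<noteq> 0"
  shows "pt u = pt v \<longleftrightarrow> (\<exists>c. u = c *s v)"
proof
  assume "pt u = pt v"
  then have "range (\<lambda>k. k *s u) = range (\<lambda>k. k *s v)"
    using Rep_pt[OF assms(1)] Rep_pt[OF assms(2)] by simp
  moreover have "u \<in> range (\<lambda>k. k *s u)"
    using vec.scale_one[of u] by (metis rangeI)
  ultimately show "\<exists>c. u = c *s v" by auto
next
  assume "\<exists>c. u = c *s v"
  then obtain c where c: "u = c *s v" by auto
  then have c0: "c \<noteq> 0" using assms(1) by auto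
  have "range (\<lambda>k. k *s u) = range (\<lambda>k. k *s v)"
  proof (intro equalityI subsetI)
    fix x assume "x \<in> range (\<lambda>k. k *s v)"
    then obtain k where "x = k *s v" by auto
    then have "x = (k / c) *s u" using c c0 by simp
    then show "x \<in> range (\<lambda>k. k *s u)" by auto
  qed (auto simp: c)
  then have "Rep_cp2 (pt u) = Rep_cp2 (pt v)"
    using Rep_pt[OF assms(1)] Rep_pt[OF assms(2)] by simp
  then show "pt u = pt v" by (simp add: Rep_cp2_inject)
qed

section \<open>The complex cross product and the incidence of lines\<close>

definition cross :: "complex^3 \<Rightarrow> complex^3 \<Rightarrow> complex^3" where
  "cross a b = vector [a$2 * b$3 - a$3 * b$2, a$3 * b$1 - a$1 * b$3, a$1 * b$2 - a$2 * b$1]"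

lemma cross_component [simp]:
  "cross a b $ 1 = a$2 * b$3 - a$3 * b$2"
  "cross a b $ 2 = a$3 * b$1 - a$1 * b$3"
  "cross a b $ 3 = a$1 * b$2 - a$2 * b$1"
  by (auto simp: cross_def)

lemma dot_cross_self [simp]: "dot a (cross a b) = 0" "dot b (cross a b) = 0"
  "dot (cross a b) a = 0" "dot (cross a b) b = 0"
  by (auto simp: dot_def algebra_simps)

lemma cross_eq_0:
  assumes "a \<noteq> 0" "cross a b = 0"
  shows "\<exists>c. b = c *s a"
proof -
  have e: "a$2 * b$3 = a$3 * b$2" "a$3 * b$1 = a$1 * b$3" "a$1 * b$2 = a$2 * b$1"
    using assms(2) by (auto simp: vec3_eq_iff)
  have "a$1 \<noteq> 0 \<or> a$2 \<noteq> 0 \<or> a$3 \<noteq> 0"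
    using assms(1) by (auto simp: vec3_eq_iff)
  then show ?thesis
  proof (elim disjE)
    assume "a$1 \<noteq> 0"
    with e have "b = (b$1 / a$1) *s a" by (auto simp: vec3_eq_iff field_simps)
    then show ?thesis by blast
  next
    assume "a$2 \<noteq> 0"
    with e have "b = (b$2 / a$2) *s a" by (auto simp: vec3_eq_iff field_simps)
    then show ?thesis by blast
  next
    assume "a$3 \<noteq> 0"
    with e have "b = (b$3 / a$3) *s a" by (auto simp: vec3_eq_iff field_simps)
    then show ?thesis by blast
  qed
qed

lemma cross_cross: "cross (cross a b) v = dot a v *s b - dot b v *s a"
  by (auto simp: vec3_eq_iff dot_def algebra_simps)

text \<open>By the double cross product identity, a common zero \<open>v\<close> of \<open>a\<close>
  and \<open>b\<close> has zero cross product with \<open>cross a b\<close>, hence is proportional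
  to it. So \<open>cross a b\<close> represents the intersection of the two lines.\<close>

lemma common_zero_unique:
  assumes "cross a b \<noteq> 0" "dot a v = 0" "dot b v = 0"
  shows "\<exists>c. v = c *s cross a b"
  using assms by (intro cross_eq_0) (auto simp: cross_cross)

lemma line_of_scale: "c \<noteq> 0 \<Longrightarrow> line_of (c *s a) = line_of a"
  unfolding line_of_def dot_sum by simp

definition is_line :: "cp2 set \<Rightarrow> bool" where
  "is_line l \<longleftrightarrow> (\<exists>a. a \<noteq> 0 \<and> l = line_of a)"

lemma lines_meet:
  assumes "is_line l" "is_line l'" "l \<noteq> l'"
  shows "\<exists>p. l \<inter> l' = {p}"
proof -
  obtain a b where ab: "a \<noteq> 0" "l = line_of a" "b \<noteq> 0" "l' = line_of b"
    using assms by (auto simp: is_line_def)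
  have c: "cross a b \<noteq> 0"
  proof
    assume "cross a b = 0"
    then obtain c where "b = c *s a" using ab(1) cross_eq_0 by blast
    moreover then have "c \<noteq> 0" using ab(3) by auto
    ultimately show False using ab assms(3) line_of_scale by auto
  qed
  have "p = pt (cross a b)" if p: "p \<in> l" "p \<in> l'" for p
  proof -
    obtain v where "v \<noteq> 0" "p = pt v" by (rule cp2_cases)
    then show ?thesis
      using p ab c common_zero_unique[of a b v] by (auto simp: pt_eq_iff)
  qed
  moreover have "pt (cross a b) \<in> l \<inter> l'" using c ab by simp
  ultimately show ?thesis by blast
qed

text \<open>With independent zeros \<open>u\<close> and \<open>v\<close> of the form, the points
  \<open>u + t v\<close> are pairwise distinct for complex \<open>t\<close>. This later excludes a
  line common to two blocks, as it would lie in the finite base.\<close>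

lemma line_infinite:
  assumes "is_line l"
  shows "infinite l"
proof -
  obtain a where a: "a \<noteq> 0" "l = line_of a"
    using assms by (auto simp: is_line_def)
  have "\<exists>u v. dot a u = 0 \<and> dot a v = 0 \<and> cross u v \<noteq> 0"
  proof -
    \<comment> \<open>These three vectors span the plane of zeros of \<open>a\<close>, so two of
      them are independent.\<close>
    let ?u = "cross a (axis 1 1)" and ?v = "cross a (axis 2 1)" and ?w = "cross a (axis 3 1)"
    have "cross ?u ?v \<noteq> 0 \<or> cross ?u ?w \<noteq> 0 \<or> cross ?v ?w \<noteq> 0"
      using a(1) by (auto simp: vec3_eq_iff axis_def)
    then show ?thesis using dot_cross_self(1)[of a] by blast
  qed
  then obtain u v where uv: "dot a u = 0" "dot a v = 0" "cross u v \<noteq> 0" by blast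
  \<comment> \<open>The cross product of two members of the family detects the difference of their
    parameters; this gives both that no member vanishes and injectivity.\<close>
  have c: "cross (u + s *s v) (u + t *s v) = (t - s) *s cross u v" for s t
    by (auto simp: vec3_eq_iff algebra_simps)
  have nz: "u + t *s v \<noteq> 0" for t
  proof
    assume "u + t *s v = 0"
    then have "cross (u + t *s v) (u + (t + 1) *s v) = 0" by (simp add: vec3_eq_iff)
    then show False using c[of t "t + 1"] uv(3) by auto
  qed
  have "inj (\<lambda>t. pt (u + t *s v))"
  proof (rule injI)
    fix s t assume "pt (u + s *s v) = pt (u + t *s v)"
    then obtain k where "u + s *s v = k *s (u + t *s v)"
      using pt_eq_iff nz by blast
    then have "cross (u + s *s v) (u + t *s v) = 0"
      by (simp only:) (simp add: vec3_eq_iff algebra_simps)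
    then show "s = t" using c[of s t] uv(3) by auto
  qed
  then have "infinite (range (\<lambda>t. pt (u + t *s v)))"
    using finite_imageD infinite_UNIV_char_0 by blast
  moreover have "range (\<lambda>t. pt (u + t *s v)) \<subseteq> l"
    using uv nz unfolding a(2) by auto
  ultimately show ?thesis using finite_subset by blast
qed

section \<open>Projective transformations\<close>

lemma matrix_vector_nonzero:
  assumes "invertible (M :: complex^3^3)" "v \<noteq> 0"
  shows "M *v v \<noteq> 0"
  using assms inj_matrix_vector_mult[OF assms(1)] by (metis injD matrix_vector_mult_0_right)

lemma proj_map_pt:
  assumes "invertible M" "v \<noteq> 0"
  shows "proj_map M (pt v) = pt (M *v v)"
proof -
  have "(\<lambda>w. M *v w) ` range (\<lambda>k. k *s v) = range (\<lambda>k. k *s (M *v v))"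
    by (auto simp: vector_scalar_commute image_def)
  then show ?thesis
    using assms by (simp add: proj_map_def Rep_pt) (simp add: pt_def vec.span_singleton)
qed

lemma dot_vector_matrix: "dot (a v* M) v = dot a (M *v v)"
  by (simp add: dot_def matrix_vector_mult_def vector_matrix_mult_def sum_3 algebra_simps)

lemma matrix_inv_mult:
  assumes "invertible (M :: complex^3^3)"
  shows "M ** matrix_inv M = mat 1" "matrix_inv M ** M = mat 1"
proof -
  have "M ** matrix_inv M = mat 1 \<and> matrix_inv M ** M = mat 1"
    using assms unfolding invertible_def matrix_inv_def by (rule someI_ex)
  then show "M ** matrix_inv M = mat 1" "matrix_inv M ** M = mat 1" by simp_all
qed

lemma matrix_inv_vec:
  assumes "invertible (M :: complex^3^3)"
  shows "M *v (matrix_inv M *v v) = v" "matrix_inv M *v (M *v v) = v"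
  using assms by (auto simp: matrix_vector_mul_assoc matrix_inv_mult)

lemma invertible_matrix_inv: "invertible M \<Longrightarrow> invertible (matrix_inv (M :: complex^3^3))"
  using invertible_def matrix_inv_mult by blast

lemma proj_map_inv:
  assumes "invertible M"
  shows "proj_map M (proj_map (matrix_inv M) p) = p" "proj_map (matrix_inv M) (proj_map M p) = p"
proof -
  obtain v where "v \<noteq> 0" "p = pt v" by (rule cp2_cases)
  then show "proj_map M (proj_map (matrix_inv M) p) = p" "proj_map (matrix_inv M) (proj_map M p) = p"
    using assms invertible_matrix_inv[OF assms]
    by (auto simp: proj_map_pt matrix_vector_nonzero matrix_inv_vec)
qed

text \<open>Since \<open>(a v* M) v = a (M v)\<close>, moving points by the inverse of
  \<open>M\<close> moves forms by \<open>a v* M\<close>. Transforming by \<open>matrix_inv M\<close>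
  throughout keeps inverses out of the coefficients.\<close>

lemma proj_map_image_line:
  assumes "invertible M"
  shows "proj_map (matrix_inv M) ` line_of a = line_of (a v* M)"
proof -
  have *: "proj_map M p \<in> line_of a \<longleftrightarrow> p \<in> line_of (a v* M)" for p
  proof -
    obtain v where "v \<noteq> 0" "p = pt v" by (rule cp2_cases)
    then show ?thesis
      using assms by (simp add: proj_map_pt matrix_vector_nonzero dot_vector_matrix)
  qed
  show ?thesis
  proof (intro equalityI subsetI)
    fix q assume "q \<in> line_of (a v* M)"
    then have "proj_map M q \<in> line_of a" using * by simp
    moreover have "q = proj_map (matrix_inv M) (proj_map M q)"
      using assms proj_map_inv by simp
    ultimately show "q \<in> proj_map (matrix_inv M) ` line_of a" by blast
  qed (use * assms proj_map_inv in fastforce)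
qed

section \<open>Three concurrent blocks\<close>

text \<open>What remains of a complete net once the polynomials are forgotten: three pencils of
  lines with centres \<open>p i\<close>, apart from each other, with the third block passing through
  all intersections of the first two.\<close>

definition concurrent_net :: "nat \<Rightarrow> (nat \<Rightarrow> cp2 set set) \<Rightarrow> (nat \<Rightarrow> cp2) \<Rightarrow> bool" where
  "concurrent_net n B p \<longleftrightarrow>
     (\<forall>i<3. finite (B i) \<and> card (B i) = n \<and> (\<forall>l\<in>B i. is_line l \<and> p i \<in> l)) \<and>
     (\<forall>i<3. \<forall>j<3. i \<noteq> j \<longrightarrow> (\<forall>l\<in>B i. p j \<notin> l)) \<and>
     (\<forall>l\<in>B 0. \<forall>l'\<in>B 1. \<exists>l''\<in>B 2. l \<inter> l' \<inter> l'' \<noteq> {})"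

lemma concurrent_netD:
  assumes "concurrent_net n B p"
  shows "\<And>l i. i < 3 \<Longrightarrow> l \<in> B i \<Longrightarrow> is_line l \<and> p i \<in> l"
    and "\<And>l i j. i < 3 \<Longrightarrow> j < 3 \<Longrightarrow> i \<noteq> j \<Longrightarrow> l \<in> B i \<Longrightarrow> p j \<notin> l"
    and "\<And>i. i < 3 \<Longrightarrow> finite (B i)" "\<And>i. i < 3 \<Longrightarrow> card (B i) = n"
    and "\<And>l l'. l \<in> B 0 \<Longrightarrow> l' \<in> B 1 \<Longrightarrow> \<exists>l''\<in>B 2. l \<inter> l' \<inter> l'' \<noteq> {}"
  using assms by (simp_all add: concurrent_net_def)

lemma concurrent_net_proj_map:
  assumes net: "concurrent_net n B p" and M: "invertible M"
  shows "concurrent_net n (\<lambda>i. (`) (proj_map (matrix_inv M)) ` B i) (\<lambda>i. proj_map (matrix_inv M) (p i))"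
proof -
  let ?f = "proj_map (matrix_inv M)"
  have inj: "inj ?f"
    by (rule inj_on_inverseI[where g = "proj_map M"]) (simp add: proj_map_inv M)
  have "inj ((`) ?f)"
    using inj by (simp add: inj_image_eq_iff inj_def)
  then have card: "card ((`) ?f ` L) = card L" for L :: "cp2 set set"
    by (intro card_image) (auto intro: inj_on_subset)
  have line: "is_line (?f ` l)" if l: "is_line l" for l
  proof -
    obtain a where a: "a \<noteq> 0" "l = line_of a" using l by (auto simp: is_line_def)
    \<comment> \<open>The new form is nonzero because the transpose of \<open>M\<close> is
      invertible too.\<close>
    have "a v* M \<noteq> 0"
    proof
      assume "a v* M = 0"
      then have "transpose M *v a = 0" by simp
      moreover have "invertible (transpose M)"
        using M by (simp add: invertible_det_nz)
      ultimately show False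
        using a(1) matrix_vector_nonzero by blast
    qed
    then show ?thesis
      unfolding is_line_def a(2) proj_map_image_line[OF M] by blast
  qed
  have meet: "?f ` l \<inter> ?f ` l' \<inter> ?f ` l'' = ?f ` (l \<inter> l' \<inter> l'')" for l l' l''
    using inj by (simp add: image_Int)
  show ?thesis
    using net line by (simp add: concurrent_net_def card inj_image_mem_iff[OF inj] meet)
qed

section \<open>Blocks as sets of complex parameters\<close>

lemma card_param:
  assumes "inj g" "\<And>l. l \<in> L \<Longrightarrow> \<exists>a. l = g a"
  shows "card {a. g a \<in> L} = card L" and "g ` {a. g a \<in> L} = L"
proof -
  show *: "g ` {a. g a \<in> L} = L" using assms(2) by blast
  then show "card {a. g a \<in> L} = card L"
    using card_image[of g "{a. g a \<in> L}"] assms(1) by (metis inj_on_subset subset_UNIV)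
qed

lemma finite_param: "inj g \<Longrightarrow> finite L \<Longrightarrow> finite {a. g a \<in> L}"
  using finite_vimageI[of L g] by (simp add: vimage_def)

text \<open>For fixed \<open>a\<close> the map \<open>b \<mapsto> y * b - x * a\<close> is an
  injection of \<open>B\<close> into \<open>C\<close>, hence onto by cardinality. Summing its values
  gives \<open>card B * x * a = \<Sum>\<close> of \<open>y * b\<close> over \<open>B\<close> minus
  the sum of \<open>C\<close>, which leaves only one value for \<open>a\<close>.\<close>

lemma sumset_small:
  fixes A B C :: "complex set"
  assumes "finite B" "finite C" "card B = card C" "card B > 0" "x \<noteq> 0" "y \<noteq> 0"
    and sub: "\<And>a b. a \<in> A \<Longrightarrow> b \<in> B \<Longrightarrow> y * b - x * a \<in> C"
  shows "card A \<le> 1"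
proof -
  have *: "of_nat (card B) * (x * a) = y * \<Sum>B - \<Sum>C" if "a \<in> A" for a
  proof -
    have inj: "inj_on (\<lambda>b. y * b - x * a) B"
      using \<open>y \<noteq> 0\<close> by (auto simp: inj_on_def)
    have "(\<lambda>b. y * b - x * a) ` B = C"
      using assms that card_image[OF inj] by (intro card_subset_eq) auto
    then have "\<Sum>C = (\<Sum>b\<in>B. y * b - x * a)"
      using sum.reindex[OF inj, of id] by simp
    then show ?thesis by (simp add: sum_subtractf sum_distrib_left)
  qed
  have "a = a'" if "a \<in> A" "a' \<in> A" for a a'
  proof -
    have "of_nat (card B) * (x * a) = of_nat (card B) * (x * a')"
      using *[OF that(1)] *[OF that(2)] by simp
    then show ?thesis using assms(4,5) by simp
  qed
  then show ?thesis
    \<comment> \<open>In the infinite case \<open>card A\<close> is \<open>0\<close> by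
      convention.\<close>
    by (cases "finite A") (auto simp: card_le_Suc0_iff_eq)
qed

text \<open>For fixed \<open>r\<close>, dividing \<open>S\<close> by \<open>r\<close> gives all of
  \<open>T\<close>, so the product of \<open>T\<close> is that of \<open>S\<close> divided by
  \<open>r ^ n\<close>; comparison with \<open>r = 1\<close> yields \<open>r ^ n = 1\<close>. Fixing
  \<open>s\<close> instead and comparing with \<open>s = 1\<close> yields \<open>s ^ n = 1\<close>.
  Cardinality turns the inclusions into equalities.\<close>

lemma quotient_set_roots_of_unity:
  fixes R S T :: "complex set"
  assumes fin: "finite R" "finite S" "finite T" and card: "card R = n" "card S = n" "card T = n"
    and n: "n > 0" and nz: "0 \<notin> R" "0 \<notin> S" "0 \<notin> T" and one: "1 \<in> R" "1 \<in> S"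
    and quot: "\<And>r s. r \<in> R \<Longrightarrow> s \<in> S \<Longrightarrow> s / r \<in> T"
  shows "R = {z. z ^ n = 1}" "S = {z. z ^ n = 1}" "T = {z. z ^ n = 1}"
proof -
  let ?U = "{z :: complex. z ^ n = 1}"
  have U: "finite ?U" "card ?U = n"
    using n card_roots_unity_eq[of n] finite_roots_unity[of n] by auto
  have p0: "\<Prod>R \<noteq> 0" "\<Prod>S \<noteq> 0" "\<Prod>T \<noteq> 0"
    using nz fin by (auto simp: prod_zero_iff)
  have imS: "(\<lambda>s. s / r) ` S = T" "\<Prod>T = \<Prod>S / r ^ n" if "r \<in> R" for r
  proof -
    have inj: "inj_on (\<lambda>s. s / r) S"
      using nz that by (auto simp: inj_on_def)
    show *: "(\<lambda>s. s / r) ` S = T"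
      using fin card that quot card_image[OF inj] by (intro card_subset_eq) auto
    then show "\<Prod>T = \<Prod>S / r ^ n"
      using prod.reindex[OF inj, of id] card by (simp add: prod_dividef)
  qed
  have imR: "\<Prod>T = s ^ n / \<Prod>R" if "s \<in> S" for s
  proof -
    have inj: "inj_on (\<lambda>r. s / r) R"
      using nz that by (auto simp: inj_on_def field_simps)
    have "(\<lambda>r. s / r) ` R = T"
      using fin card that quot card_image[OF inj] by (intro card_subset_eq) auto
    then show ?thesis
      using prod.reindex[OF inj, of id] card by (simp add: prod_dividef)
  qed
  have "R \<subseteq> ?U"
  proof
    fix r assume "r \<in> R"
    then have "\<Prod>S / r ^ n = \<Prod>S" "r \<noteq> 0" using imS(2)[of r] imS(2)[of 1] one nz by auto
    then show "r \<in> ?U" using p0 by (simp add: field_simps)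
  qed
  then show "R = ?U" using U card by (intro card_subset_eq) auto
  have "S \<subseteq> ?U"
  proof
    fix s assume "s \<in> S"
    then have "s ^ n / \<Prod>R = 1 / \<Prod>R" using imR[of s] imR[of 1] one by simp
    then show "s \<in> ?U" using p0 by (simp add: field_simps)
  qed
  then show S: "S = ?U" using U card by (intro card_subset_eq) auto
  show "T = ?U" using imS(1)[OF one(1)] S by simp
qed

lemma vector3_eq_0 [simp]: "(vector [a, b, c] :: complex^3) = 0 \<longleftrightarrow> a = 0 \<and> b = 0 \<and> c = 0"
  by (simp add: vec3_eq_iff)

lemma dot_vector [simp]: "dot a (vector [x, y, z]) = a$1 * x + a$2 * y + a$3 * z"
  "dot (vector [x, y, z]) a = x * a$1 + y * a$2 + z * a$3"
  by (simp_all add: dot_def)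

lemma line_of_eqI: "b \<noteq> 0 \<Longrightarrow> b = c *s a \<Longrightarrow> line_of b = line_of a"
  using line_of_scale[of c a] by (cases "c = 0") auto

lemma concurrent_lines:
  assumes "line_of a \<inter> line_of b \<inter> line_of c \<noteq> {}"
  obtains u where "u \<noteq> 0" "dot a u = 0" "dot b u = 0" "dot c u = 0"
proof -
  obtain p where p: "p \<in> line_of a" "p \<in> line_of b" "p \<in> line_of c" using assms by auto
  obtain u where "u \<noteq> 0" "p = pt u" by (rule cp2_cases)
  with p show thesis using that by simp
qed

text \<open>All centres lie on the line where the third coordinate is zero. Away from it the blocks
  are three families of parallel lines, determined by their constant terms, and
  \<open>sumset_small\<close> bounds the size of the first block by 1.\<close>

lemma concurrent_net_collinear_False:
  assumes net: "concurrent_net n B p" and n: "n \<ge> 2"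
    and p: "p 0 = pt (vector [1, 0, 0])" "p 1 = pt (vector [0, 1, 0])" "p 2 = pt (vector [x, y, 0])"
    and xy: "x \<noteq> 0 \<or> y \<noteq> 0"
  shows False
proof -
  note pts = concurrent_netD(1,2)[OF net] and fin = concurrent_netD(3,4)[OF net]
    and meet = concurrent_netD(5)[OF net]
  have vxy: "vector [x, y, 0] \<noteq> (0 :: complex^3)" using xy by auto
  \<comment> \<open>A line of the third block misses the first two centres, so its first two
    coefficients are nonzero; passing through \<open>(x : y : 0)\<close> then makes \<open>x\<close>
    and \<open>y\<close> both nonzero.\<close>
  have B2: "x \<noteq> 0 \<and> y \<noteq> 0 \<and> (\<exists>c. l = line_of (vector [y, -x, c]))" if l: "l \<in> B 2" for l
  proof -
    obtain c where c: "c \<noteq> 0" "l = line_of c" using pts(1)[OF _ l] by (auto simp: is_line_def)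
    have e: "c$1 * x + c$2 * y = 0" "c$1 \<noteq> 0" "c$2 \<noteq> 0"
      using pts(1)[OF _ l] pts(2)[OF _ _ _ l, of 0] pts(2)[OF _ _ _ l, of 1] vxy
      by (auto simp: c(2) p p(2)[unfolded One_nat_def])
    then have xy0: "x \<noteq> 0" "y \<noteq> 0" using xy by auto
    have "c$2 * y = - (c$1 * x)" using e(1) by (simp add: eq_neg_iff_add_eq_0 add.commute)
    then have "c$2 = c$1 / y * (- x)" using xy0 by (simp add: field_simps)
    then have "c = (c$1 / y) *s vector [y, -x, c$3 * y / c$1]"
      using e(2) xy0 by (simp add: vec3_eq_iff)
    then have "l = line_of (vector [y, -x, c$3 * y / c$1])"
      using c line_of_eqI by blast
    then show ?thesis using xy0 by blast
  qed
  have B0: "\<exists>a. l = line_of (vector [0, 1, a])" if l: "l \<in> B 0" for l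
  proof -
    obtain c where c: "c \<noteq> 0" "l = line_of c" using pts(1)[OF _ l] by (auto simp: is_line_def)
    have e: "c$1 = 0" "c$2 \<noteq> 0"
      using pts(1)[OF _ l] pts(2)[OF _ _ _ l, of 1] by (auto simp: c(2) p p(2)[unfolded One_nat_def])
    have "c = c$2 *s vector [0, 1, c$3 / c$2]"
      using e by (simp add: vec3_eq_iff)
    then show ?thesis using c line_of_eqI by blast
  qed
  have B1: "\<exists>b. l = line_of (vector [1, 0, b])" if l: "l \<in> B 1" for l
  proof -
    obtain c where c: "c \<noteq> 0" "l = line_of c" using pts(1)[OF _ l] by (auto simp: is_line_def)
    have e: "c$2 = 0" "c$1 \<noteq> 0"
      using pts(1)[OF _ l] pts(2)[OF _ _ _ l, of 0] by (auto simp: c(2) p p(2)[unfolded One_nat_def])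
    have "c = c$1 *s vector [1, 0, c$3 / c$1]"
      using e by (simp add: vec3_eq_iff)
    then show ?thesis using c line_of_eqI by blast
  qed
  have "B 2 \<noteq> {}" using fin[of 2] n by auto
  then have xy0: "x \<noteq> 0" "y \<noteq> 0" using B2 by auto
  have sep: "line_of a \<noteq> line_of b" if "v \<noteq> 0" "dot a v = 0" "dot b v \<noteq> 0" for a b v
    using that by (metis pt_in_line_of)
  let ?g0 = "\<lambda>a. line_of (vector [0, 1, a])" and ?g1 = "\<lambda>a. line_of (vector [1, 0, a])"
    and ?g2 = "\<lambda>c. line_of (vector [y, -x, c])"
  have inj: "inj ?g0" "inj ?g1" "inj ?g2"
  proof -
    show "inj ?g0"
    proof (rule injI, rule ccontr)
      fix a b assume "?g0 a = ?g0 b" "a \<noteq> b"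
      then show False using sep[of "vector [0, a, -1]" "vector [0, 1, a]" "vector [0, 1, b]"] by simp
    qed
    show "inj ?g1"
    proof (rule injI, rule ccontr)
      fix a b assume "?g1 a = ?g1 b" "a \<noteq> b"
      then show False using sep[of "vector [a, 0, -1]" "vector [1, 0, a]" "vector [1, 0, b]"] by simp
    qed
    show "inj ?g2"
    proof (rule injI, rule ccontr)
      fix a b assume "?g2 a = ?g2 b" "a \<noteq> b"
      then show False
        using sep[of "vector [a, 0, -y]" "vector [y, -x, a]" "vector [y, -x, b]"] xy0 by simp
    qed
  qed
  define A where "A = {a. ?g0 a \<in> B 0}"
  define Bs where "Bs = {a. ?g1 a \<in> B 1}"
  define C where "C = {a. ?g2 a \<in> B 2}"
  have card: "card A = n" "card Bs = n" "card C = n" "finite Bs" "finite C"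
    using card_param(1)[OF inj(1) B0] card_param(1)[OF inj(2) B1] card_param(1)[OF inj(3)] B2 fin
      finite_param[OF inj(2)] finite_param[OF inj(3)]
    unfolding A_def Bs_def C_def by auto
  \<comment> \<open>The lines with parameters \<open>a\<close> and \<open>b\<close> meet in
    \<open>(-b : -a : 1)\<close>, and the line of the third block through this point has constant
    term \<open>y * b - x * a\<close>.\<close>
  have "y * b - x * a \<in> C" if ab: "a \<in> A" "b \<in> Bs" for a b
  proof -
    obtain l where l: "l \<in> B 2" "?g0 a \<inter> ?g1 b \<inter> l \<noteq> {}"
      using meet ab unfolding A_def Bs_def by blast
    obtain c where c: "l = ?g2 c" using B2 l by blast
    obtain u :: "complex^3" where u: "u \<noteq> 0" "u$2 + a * u$3 = 0" "u$1 + b * u$3 = 0" "y * u$1 - x * u$2 + c * u$3 = 0"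
      using l(2) unfolding c by (rule concurrent_lines) simp
    then have e: "u$2 = - a * u$3" "u$1 = - b * u$3" by (simp_all add: eq_neg_iff_add_eq_0)
    have "u$3 \<noteq> 0" using u(1) e by (auto simp: vec3_eq_iff)
    moreover have "(c - (y * b - x * a)) * u$3 = 0" using u(4) unfolding e by (simp add: algebra_simps)
    ultimately have "c = y * b - x * a" by simp
    then show ?thesis using l(1) c C_def by simp
  qed
  then have "card A \<le> 1"
    using card n xy0 by (intro sumset_small[of Bs C x y]) auto
  then show False using card n by simp
qed

text \<open>Linear factors of the three brackets, in the order of \<open>fermat_factors\<close>,
  when \<open>z\<close> is an \<open>n\<close>-th root of unity. For fixed \<open>i\<close> they
  parametrize lines through \<open>(0:0:1)\<close>, \<open>(0:1:0)\<close> and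
  \<open>(1:0:0)\<close> respectively.\<close>

definition fermat_vec :: "nat \<Rightarrow> complex \<Rightarrow> complex^3" where
  "fermat_vec i z = [vector [1, -z, 0], vector [1, 0, -z], vector [0, 1, -z]] ! i"

lemma fermat_vec_simps:
  "fermat_vec 0 z = vector [1, -z, 0]"
  "fermat_vec 1 z = vector [1, 0, -z]" "fermat_vec (Suc 0) z = vector [1, 0, -z]"
  "fermat_vec 2 z = vector [0, 1, -z]"
  by (simp_all add: fermat_vec_def)

lemma less_3_cases: "i < (3::nat) \<longleftrightarrow> i = 0 \<or> i = 1 \<or> i = 2"
  by auto

lemma fermat_vec_nonzero: "i < 3 \<Longrightarrow> fermat_vec i z \<noteq> 0"
  by (auto simp: less_3_cases fermat_vec_simps)

lemma inj_fermat_line: "i < 3 \<Longrightarrow> inj (\<lambda>z. line_of (fermat_vec i z))"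
proof (rule injI, rule ccontr)
  fix a b assume i: "i < 3" and e: "line_of (fermat_vec i a) = line_of (fermat_vec i b)" "a \<noteq> b"
  \<comment> \<open>The witnesses are zeros of the form with parameter \<open>a\<close>; the form
    with parameter \<open>b\<close> takes the value \<open>a - b\<close> there.\<close>
  have "\<exists>v. v \<noteq> 0 \<and> dot (fermat_vec i a) v = 0 \<and> dot (fermat_vec i b) v \<noteq> 0"
    using i e(2) unfolding less_3_cases
  proof (elim disjE)
    assume "i = 0" then show ?thesis using e(2)
      by (intro exI[of _ "vector [a, 1, 0]"]) (simp add: fermat_vec_simps)
  next
    assume "i = 1" then show ?thesis using e(2)
      by (intro exI[of _ "vector [a, 0, 1]"]) (simp add: fermat_vec_simps)
  next
    assume "i = 2" then show ?thesis using e(2)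
      by (intro exI[of _ "vector [0, a, 1]"]) (simp add: fermat_vec_simps)
  qed
  then obtain v where "v \<noteq> 0" "dot (fermat_vec i a) v = 0" "dot (fermat_vec i b) v \<noteq> 0" by blast
  then show False using e(1) pt_in_line_of[of v] by metis
qed

text \<open>Lines with nonzero parameters \<open>r\<close>, \<open>s\<close>, \<open>t\<close> from
  the three blocks are concurrent only if \<open>s = r * t\<close>, so the parameter sets satisfy
  the hypotheses of \<open>quotient_set_roots_of_unity\<close>. The two lines assumed in
  \<open>one\<close> supply the parameter \<open>1\<close> in the first two sets.\<close>

lemma concurrent_net_triangle:
  assumes net: "concurrent_net n B p" and n: "n \<ge> 2"
    and p: "p 0 = pt (vector [0, 0, 1])" "p 1 = pt (vector [0, 1, 0])" "p 2 = pt (vector [1, 0, 0])"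
    and one: "line_of (fermat_vec 0 1) \<in> B 0" "line_of (fermat_vec 1 1) \<in> B 1"
    and i: "i < 3"
  shows "B i = (\<lambda>z. line_of (fermat_vec i z)) ` {z. z ^ n = 1}"
proof -
  note pts = concurrent_netD(1,2)[OF net] and fin = concurrent_netD(3,4)[OF net]
    and meet = concurrent_netD(5)[OF net]
  have form: "\<exists>z. l = line_of (fermat_vec i z)" if il: "i < 3" "l \<in> B i" for i l
  proof -
    obtain c where c: "c \<noteq> 0" "l = line_of c" using pts(1)[OF il] by (auto simp: is_line_def)
    have on: "p i \<in> l" "\<And>j. j < 3 \<Longrightarrow> j \<noteq> i \<Longrightarrow> p j \<notin> l" using pts il by auto
    show ?thesis using il(1) unfolding less_3_cases
    proof (elim disjE)
      assume i: "i = 0"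
      then have "c$3 = 0" "c$1 \<noteq> 0" using on(1) on(2)[of 2] by (auto simp: c(2) p p(2)[unfolded One_nat_def])
      then have "c = c$1 *s fermat_vec i (- (c$2 / c$1))"
        by (simp add: i fermat_vec_simps vec3_eq_iff)
      then show ?thesis using c line_of_eqI by blast
    next
      assume i: "i = 1"
      then have "c$2 = 0" "c$1 \<noteq> 0" using on(1) on(2)[of 2] by (auto simp: c(2) p p(2)[unfolded One_nat_def])
      then have "c = c$1 *s fermat_vec i (- (c$3 / c$1))"
        by (simp add: i fermat_vec_simps vec3_eq_iff)
      then show ?thesis using c line_of_eqI by blast
    next
      assume i: "i = 2"
      then have "c$1 = 0" "c$2 \<noteq> 0" using on(1) on(2)[of 1] by (auto simp: c(2) p p(2)[unfolded One_nat_def])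
      then have "c = c$2 *s fermat_vec i (- (c$3 / c$2))"
        by (simp add: i fermat_vec_simps vec3_eq_iff)
      then show ?thesis using c line_of_eqI by blast
    qed
  qed
  define Z where "Z i = {z. line_of (fermat_vec i z) \<in> B i}" for i
  have Z: "finite (Z i)" "card (Z i) = n" "(\<lambda>z. line_of (fermat_vec i z)) ` Z i = B i" if "i < 3" for i
    using card_param[OF inj_fermat_line[OF that] form[OF that]]
      finite_param[OF inj_fermat_line[OF that] fin(1)[OF that]] fin(2)[OF that] unfolding Z_def by simp_all
  \<comment> \<open>A line with parameter \<open>0\<close> passes through the centre of another
    block.\<close>
  have nz: "0 \<notin> Z 0" "0 \<notin> Z 1" "0 \<notin> Z 2"
    using pts(2)[of 0 1 "line_of (fermat_vec 0 0)"] pts(2)[of 1 0 "line_of (fermat_vec 1 0)"]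
      pts(2)[of 2 0 "line_of (fermat_vec 2 0)"]
    by (auto simp: Z_def p p(2)[unfolded One_nat_def] fermat_vec_simps)
  have quot: "s / r \<in> Z 2" if rs: "r \<in> Z 0" "s \<in> Z 1" for r s
  proof -
    obtain l where l: "l \<in> B 2" "line_of (fermat_vec 0 r) \<inter> line_of (fermat_vec 1 s) \<inter> l \<noteq> {}"
      using meet rs unfolding Z_def by blast
    obtain t where t: "l = line_of (fermat_vec 2 t)" using form[OF _ l(1)] by auto
    obtain u where u0: "u \<noteq> 0"
      and d: "dot (fermat_vec 0 r) u = 0" "dot (fermat_vec 1 s) u = 0" "dot (fermat_vec 2 t) u = 0"
      using l(2) unfolding t by (rule concurrent_lines)
    have u: "u$1 = r * u$2" "u$1 = s * u$3" "u$2 = t * u$3"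
      using d by (simp_all only: fermat_vec_simps dot_vector) (simp_all add: algebra_simps)
    have "u$3 \<noteq> 0" using u u0 by (auto simp: vec3_eq_iff)
    moreover have "s * u$3 = (r * t) * u$3" using u by simp
    ultimately have "s = r * t" by (metis mult_right_cancel)
    moreover have "r \<noteq> 0" using rs nz by auto
    ultimately show ?thesis using l(1) t Z_def by simp
  qed
  have one': "1 \<in> Z 0" "1 \<in> Z 1" using one by (auto simp: Z_def)
  have finZ: "finite (Z 0)" "finite (Z 1)" "finite (Z 2)" by (rule Z(1), simp)+
  have cardZ: "card (Z 0) = n" "card (Z 1) = n" "card (Z 2) = n" by (rule Z(2), simp)+
  have "n > 0" using n by simp
  note roots = quotient_set_roots_of_unity[OF finZ cardZ this nz one' quot]
  have "Z i = {z. z ^ n = 1}"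
    using i roots unfolding less_3_cases by (elim disjE) (simp_all only:)
  then show ?thesis using Z(3)[OF i] by simp
qed

section \<open>Moving the centres into standard position\<close>

definition col_matrix :: "complex^3 \<Rightarrow> complex^3 \<Rightarrow> complex^3 \<Rightarrow> complex^3^3" where
  "col_matrix u v w = transpose (vector [u, v, w])"

lemma col_matrix_mult: "col_matrix u v w *v c = c$1 *s u + c$2 *s v + c$3 *s w"
  by (simp add: col_matrix_def vec3_eq_iff matrix_vector_mult_def sum_3 transpose_def algebra_simps)

lemma vec_col_matrix: "a v* col_matrix u v w = vector [dot a u, dot a v, dot a w]"
  by (simp add: col_matrix_def vec3_eq_iff vector_matrix_mult_def sum_3 transpose_def dot_def algebra_simps)

lemma det_col_matrix: "det (col_matrix u v w) = dot (cross u v) w"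
  by (simp add: col_matrix_def det_3 transpose_def dot_def algebra_simps)

lemma proj_map_inv_eq:
  assumes "invertible M" "c \<noteq> 0" "M *v c = k *s v" "k \<noteq> 0" "v \<noteq> 0"
  shows "proj_map (matrix_inv M) (pt v) = pt c"
proof -
  have "v = inverse k *s (k *s v)" "k *s v \<noteq> 0" using assms(4,5) by simp_all
  then have "pt v = pt (k *s v)" using pt_eq_iff assms(5) by blast
  also have "\<dots> = proj_map M (pt c)" using assms by (simp add: proj_map_pt)
  finally show ?thesis using assms(1) by (simp add: proj_map_inv)
qed

lemma concurrent_net_fermat:
  assumes net: "concurrent_net n B p" and n: "n \<ge> 2"
  shows "\<exists>T. invertible T \<and> (\<forall>i<3. (`) (proj_map T) ` B i = (\<lambda>z. line_of (fermat_vec i z)) ` {z. z ^ n = 1})"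
proof -
  note pts = concurrent_netD(1,2)[OF net] and fin = concurrent_netD(3,4)[OF net]
    and meet = concurrent_netD(5)[OF net]
  have "\<exists>w. w \<noteq> 0 \<and> p i = pt w" for i
    by (rule cp2_cases[of "p i"]) blast
  then obtain v where v: "\<And>i. v i \<noteq> 0 \<and> p i = pt (v i)"
    by metis
  have "B 0 \<noteq> {}" "B 1 \<noteq> {}" using fin[of 0] fin[of 1] n by auto
  then obtain l0 l1 where l: "l0 \<in> B 0" "l1 \<in> B 1" by blast
  obtain a b where ab: "l0 = line_of a" "l1 = line_of b"
    using pts(1)[of 0 l0] pts(1)[of 1 l1] l by (auto simp: is_line_def)
  have a: "dot a (v 0) = 0" "dot a (v 1) \<noteq> 0" "dot a (v 2) \<noteq> 0"
    using pts(1)[of 0 l0] pts(2)[of 0 1 l0] pts(2)[of 0 2 l0] l(1) v by (auto simp: ab)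
  have b: "dot b (v 1) = 0" "dot b (v 0) \<noteq> 0" "dot b (v 2) \<noteq> 0"
    using pts(1)[of 1 l1] pts(2)[of 1 0 l1] pts(2)[of 1 2 l1] l(2) v by (auto simp: ab)
  show ?thesis
  proof (cases "dot (cross (v 0) (v 1)) (v 2) = 0")
    case True
    \<comment> \<open>The first two centres are distinct, as the form \<open>a\<close> vanishes at
      one and not at the other. Hence some \<open>w\<close> completes them to a basis.\<close>
    have "cross (v 0) (v 1) \<noteq> 0"
      using cross_eq_0[of "v 0" "v 1"] v a by auto
    then have "\<exists>w. dot (cross (v 0) (v 1)) w \<noteq> 0"
      using dot_vector(1)[of "cross (v 0) (v 1)" 1 0 0] dot_vector(1)[of "cross (v 0) (v 1)" 0 1 0]
        dot_vector(1)[of "cross (v 0) (v 1)" 0 0 1]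
      by (metis add_0 add_0_right mult_1_right mult_zero_right vec3_eq_iff zero_index)
    then obtain w where w: "dot (cross (v 0) (v 1)) w \<noteq> 0" ..
    define M where "M = col_matrix (v 0) (v 1) w"
    have M: "invertible M" using w by (simp add: M_def invertible_det_nz det_col_matrix)
    define c where "c = matrix_inv M *v v 2"
    have Mc: "M *v c = v 2" using M by (simp add: c_def matrix_inv_vec)
    \<comment> \<open>Pairing with the cross product kills the \<open>v 0\<close> and
      \<open>v 1\<close> components of \<open>M *v c = v 2\<close>, so collinearity forces the third
      new coordinate of \<open>v 2\<close> to vanish.\<close>
    have "c$3 * dot (cross (v 0) (v 1)) w = dot (cross (v 0) (v 1)) (M *v c)"
      by (simp add: M_def col_matrix_mult)
    then have c3: "c$3 = 0" using True Mc w by simp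
    have c0: "c \<noteq> 0" using Mc v[of 2] by auto
    have c: "c = vector [c$1, c$2, 0]" using c3 by (simp add: vec3_eq_iff)
    have xy: "c$1 \<noteq> 0 \<or> c$2 \<noteq> 0" using c0 c3 by (auto simp: vec3_eq_iff)
    have "M *v vector [1, 0, 0] = 1 *s v 0" "M *v vector [0, 1, 0] = 1 *s v 1"
      "M *v vector [c$1, c$2, 0] = 1 *s v 2"
      using Mc c by (simp_all add: M_def col_matrix_mult)
    then have "proj_map (matrix_inv M) (p 0) = pt (vector [1, 0, 0])"
         "proj_map (matrix_inv M) (p 1) = pt (vector [0, 1, 0])"
         "proj_map (matrix_inv M) (p 2) = pt (vector [c$1, c$2, 0])"
      using v xy proj_map_inv_eq[OF M _ _ one_neq_zero] by (metis vector3_eq_0 one_neq_zero)+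
    then have False
      by (rule concurrent_net_collinear_False[OF concurrent_net_proj_map[OF net M] n _ _ _ xy])
    then show ?thesis ..
  next
    case False
    \<comment> \<open>The centres fix the new coordinates only up to scaling the axes. The factors
      \<open>k0\<close> and \<open>k1\<close> use this freedom to turn \<open>l0\<close> and
      \<open>l1\<close> into the lines with parameter \<open>1\<close>.\<close>
    define k1 where "k1 = - (dot a (v 2) / dot a (v 1))"
    define k0 where "k0 = - (dot b (v 2) / dot b (v 0))"
    have k: "k0 * dot b (v 0) = - dot b (v 2)" "k1 * dot a (v 1) = - dot a (v 2)"
      using a b by (auto simp: k0_def k1_def)
    have k': "k0 \<noteq> 0" "k1 \<noteq> 0" using a b by (auto simp: k0_def k1_def)
    \<comment> \<open>The centres appear in reverse order because block \<open>0\<close> of the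
      Fermat arrangement has its centre at \<open>(0 : 0 : 1)\<close>.\<close>
    define M where "M = col_matrix (v 2) (k1 *s v 1) (k0 *s v 0)"
    have "det M = - (k0 * k1 * dot (cross (v 0) (v 1)) (v 2))"
      by (simp add: M_def det_col_matrix) (simp add: dot_def algebra_simps)
    then have M: "invertible M" using False k' by (simp add: invertible_det_nz)
    let ?f = "proj_map (matrix_inv M)"
    have e: "M *v vector [1, 0, 0] = 1 *s v 2" "M *v vector [0, 1, 0] = k1 *s v 1"
      "M *v vector [0, 0, 1] = k0 *s v 0"
      by (simp_all add: M_def col_matrix_mult)
    have f: "?f (p 0) = pt (vector [0, 0, 1])" "?f (p 1) = pt (vector [0, 1, 0])"
      "?f (p 2) = pt (vector [1, 0, 0])"
      using v proj_map_inv_eq[OF M _ e(1) one_neq_zero] proj_map_inv_eq[OF M _ e(2) k'(2)]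
        proj_map_inv_eq[OF M _ e(3) k'(1)] by simp_all
    have "?f ` l0 = line_of (fermat_vec 0 1)"
    proof -
      have "a v* M = dot a (v 2) *s fermat_vec 0 1"
        using a k(2) by (simp add: M_def vec_col_matrix fermat_vec_simps vec3_eq_iff)
      then show ?thesis using a by (simp add: ab proj_map_image_line[OF M] line_of_scale)
    qed
    then have m0: "line_of (fermat_vec 0 1) \<in> (`) ?f ` B 0" using l by (metis imageI)
    have "?f ` l1 = line_of (fermat_vec 1 1)"
    proof -
      have "b v* M = dot b (v 2) *s fermat_vec 1 1"
        using b k(1) by (simp add: M_def vec_col_matrix fermat_vec_simps vec3_eq_iff)
      then show ?thesis using b by (simp add: ab proj_map_image_line[OF M] line_of_scale)
    qed
    then have m1: "line_of (fermat_vec 1 1) \<in> (`) ?f ` B 1" using l by (metis imageI)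
    have "\<forall>i<3. (`) ?f ` B i = (\<lambda>z. line_of (fermat_vec i z)) ` {z. z ^ n = 1}"
      using concurrent_net_triangle[OF concurrent_net_proj_map[OF net M] n f m0 m1] by blast
    then show ?thesis using invertible_matrix_inv[OF M] by blast
  qed
qed

section \<open>Completely reducible fibers\<close>

lemma completely_reducibleD:
  assumes "completely_reducible F L m"
  shows "finite L" "\<And>l. l \<in> L \<Longrightarrow> is_line l" "\<And>l. l \<in> L \<Longrightarrow> m l > 0"
    and "F \<noteq> 0" "homogeneous3 (sum m L) F"
    and "\<And>p. vanishes_at F p \<longleftrightarrow> (\<exists>l\<in>L. p \<in> l)"
proof -
  obtain \<alpha> where L: "finite L" and \<alpha>: "\<And>l. l \<in> L \<Longrightarrow> \<alpha> l \<noteq> 0 \<and> line_of (\<alpha> l) = l \<and> m l > 0"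
    and F: "F = (\<Prod>l\<in>L. linear_form (\<alpha> l) ^ m l)"
    using assms unfolding completely_reducible_def by blast
  show "finite L" by (rule L)
  show "is_line l" "m l > 0" if "l \<in> L" for l
    using \<alpha>[OF that] unfolding is_line_def by auto
  show "F \<noteq> 0" unfolding F using L \<alpha> by (auto simp: prod_zero_iff linear_form_nonzero)
  show "homogeneous3 (sum m L) F" unfolding F
  proof (rule homogeneous3_prod)
    fix l
    show "homogeneous3 (m l) (linear_form (\<alpha> l) ^ m l)"
      using homogeneous3_power[OF homogeneous3_linear_form, of "m l" "\<alpha> l"] by simp
  qed
  fix p
  obtain v where v: "v \<noteq> 0" "p = pt v" by (rule cp2_cases)
  have zero: "eval3 F w = 0 \<longleftrightarrow> (\<exists>l\<in>L. dot (\<alpha> l) w = 0)" for w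
    using L \<alpha> by (auto simp: F eval3_prod eval3_power prod_zero_iff dot_sum)
  have "vanishes_at F p \<longleftrightarrow> (\<forall>k. \<exists>l\<in>L. k * dot (\<alpha> l) v = 0)"
    by (simp add: vanishes_at_def v Rep_pt zero)
  also have "\<dots> \<longleftrightarrow> (\<exists>l\<in>L. dot (\<alpha> l) v = 0)"
    by (auto dest: spec[of _ 1])
  also have "\<dots> \<longleftrightarrow> (\<exists>l\<in>L. p \<in> line_of (\<alpha> l))"
    using v by simp
  also have "\<dots> \<longleftrightarrow> (\<exists>l\<in>L. p \<in> l)"
    using \<alpha> by (intro bex_cong) auto
  finally show "vanishes_at F p \<longleftrightarrow> (\<exists>l\<in>L. p \<in> l)" .
qed

lemma pencil_homogeneous:
  assumes "pencil d P" "F \<in> P"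
  shows "homogeneous3 d F"
proof -
  obtain G H a b where "homogeneous3 d G" "homogeneous3 d H" "F = const3 a * G + const3 b * H"
    using assms unfolding pencil_def by blast
  then show ?thesis
    using homogeneous3_mult[OF homogeneous3_const3, of d G a]
      homogeneous3_mult[OF homogeneous3_const3, of d H b] by (simp add: homogeneous3_add)
qed

text \<open>Two distinct fibers span the pencil, so every point where both vanish is a zero of all
  members.\<close>

lemma pencil_base_eq:
  assumes "pencil d P" and Q: "Q \<in> P" "Q' \<in> P" "Q \<noteq> 0" "Q' \<noteq> 0" "\<not> same_fiber Q Q'"
  shows "pencil_base P = {p. vanishes_at Q p \<and> vanishes_at Q' p}"
proof -
  obtain F G where P: "P = {const3 a * F + const3 b * G | a b. True}"
    using assms(1) unfolding pencil_def by blast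
  obtain a b c e where ab: "Q = const3 a * F + const3 b * G" and ce: "Q' = const3 c * F + const3 e * G"
    using Q(1,2) unfolding P by blast
  \<comment> \<open>A zero determinant would make the coefficient pairs proportional and the two
    fibers equal.\<close>
  have det: "a * e - b * c \<noteq> 0"
  proof
    assume 0: "a * e - b * c = 0"
    have "\<exists>t. a = t * c \<and> b = t * e"
    proof (cases "c = 0")
      case True
      then have "e \<noteq> 0" using Q(4) ce by auto
      then show ?thesis using 0 True by (intro exI[of _ "b / e"]) auto
    next
      case False
      then show ?thesis using 0 by (intro exI[of _ "a / c"]) (auto simp: field_simps)
    qed
    then obtain t where t: "a = t * c" "b = t * e" by blast
    then have "Q = const3 t * Q'" by (simp add: ab ce const3_mult algebra_simps)
    moreover from this have "t \<noteq> 0" using Q(3) by auto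
    ultimately show False using Q(5) unfolding same_fiber_def by blast
  qed
  have "eval3 H v = 0" if H: "H \<in> P" and Qv: "eval3 Q v = 0" "eval3 Q' v = 0" for H v
  proof -
    obtain x y where xy: "H = const3 x * F + const3 y * G" using H unfolding P by blast
    have e: "a * eval3 F v + b * eval3 G v = 0" "c * eval3 F v + e * eval3 G v = 0"
      using Qv by (simp_all add: ab ce eval3_add eval3_mult)
    \<comment> \<open>Cramer's rule for the values of \<open>F\<close> and \<open>G\<close> at
      \<open>v\<close>.\<close>
    have "(a * e - b * c) * eval3 F v =
        e * (a * eval3 F v + b * eval3 G v) - b * (c * eval3 F v + e * eval3 G v)"
      "(a * e - b * c) * eval3 G v =
        a * (c * eval3 F v + e * eval3 G v) - c * (a * eval3 F v + b * eval3 G v)"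
      by (simp_all add: algebra_simps)
    then have "eval3 F v = 0" "eval3 G v = 0" using det e by simp_all
    then show ?thesis by (simp add: xy eval3_add eval3_mult)
  qed
  then show ?thesis
    using Q(1,2) unfolding pencil_base_def vanishes_at_def by blast
qed

section \<open>Multiple points of a line arrangement\<close>

definition multiple_points :: "'a set set \<Rightarrow> 'a set" where
  "multiple_points L = {p. \<exists>l\<in>L. \<exists>l'\<in>L. l \<noteq> l' \<and> p \<in> l \<inter> l'}"

text \<open>The points on one fixed line already account for \<open>card L - 1\<close>. In the case
  of equality nothing is left for points off that line; as this holds for each line, every multiple
  point lies on all lines.\<close>

lemma multiple_points_bound:
  assumes fin: "finite L"
    and meet: "\<And>l l'. l \<in> L \<Longrightarrow> l' \<in> L \<Longrightarrow> l \<noteq> l' \<Longrightarrow> \<exists>p. l \<inter> l' = {p}"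
    and L2: "card L \<ge> 2"
  shows "finite (multiple_points L)"
    and "card L - 1 \<le> (\<Sum>p\<in>multiple_points L. card {l\<in>L. p \<in> l} - 1)"
    and "(\<Sum>p\<in>multiple_points L. card {l\<in>L. p \<in> l} - 1) = card L - 1 \<Longrightarrow> \<exists>p. \<forall>l\<in>L. p \<in> l"
proof -
  let ?N = "multiple_points L" and ?c = "\<lambda>p. card {l\<in>L. p \<in> l} - 1"
  have "finite (\<Union>l\<in>L. \<Union>l'\<in>L - {l}. l \<inter> l')"
  proof (intro finite_UN_I finite_Diff fin)
    fix l l' assume "l \<in> L" "l' \<in> L - {l}"
    then obtain p where "l \<inter> l' = {p}" using meet[of l l'] by auto
    then show "finite (l \<inter> l')" by simp
  qed
  moreover have "?N = (\<Union>l\<in>L. \<Union>l'\<in>L - {l}. l \<inter> l')"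
    unfolding multiple_points_def by blast
  ultimately show N: "finite ?N" by simp
  \<comment> \<open>The other lines of \<open>L\<close> are distributed over the multiple points on \<open>l\<close>.\<close>
  have on: "card L - 1 \<le> (\<Sum>p\<in>?N \<inter> l. ?c p)" if l: "l \<in> L" for l
  proof -
    have "L - {l} \<subseteq> (\<Union>p\<in>?N \<inter> l. {l'\<in>L. p \<in> l'} - {l})"
    proof
      fix l' assume l': "l' \<in> L - {l}"
      then obtain p where "l \<inter> l' = {p}" using meet[OF l, of l'] by auto
      then have "p \<in> ?N \<inter> l" "p \<in> l'" using l l' unfolding multiple_points_def by auto
      then show "l' \<in> (\<Union>p\<in>?N \<inter> l. {l'\<in>L. p \<in> l'} - {l})" using l' by auto
    qed
    then have "card (L - {l}) \<le> card (\<Union>p\<in>?N \<inter> l. {l'\<in>L. p \<in> l'} - {l})"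
      using N fin by (intro card_mono) auto
    also have "\<dots> \<le> (\<Sum>p\<in>?N \<inter> l. card ({l'\<in>L. p \<in> l'} - {l}))"
      using N by (intro card_UN_le) auto
    also have "\<dots> = (\<Sum>p\<in>?N \<inter> l. ?c p)"
      using l by (intro sum.cong) auto
    finally show ?thesis using l fin by simp
  qed
  have split: "(\<Sum>p\<in>?N. ?c p) = (\<Sum>p\<in>?N \<inter> l. ?c p) + (\<Sum>p\<in>?N - l. ?c p)" for l
    using sum.Int_Diff[OF N] by simp
  have "L \<noteq> {}" using L2 by auto
  then obtain l0 where l0: "l0 \<in> L" by blast
  show "card L - 1 \<le> (\<Sum>p\<in>?N. ?c p)"
    using on[OF l0] split[of l0] by simp
  assume eq: "(\<Sum>p\<in>?N. ?c p) = card L - 1"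
  have sub: "?N \<subseteq> l" if l: "l \<in> L" for l
  proof
    fix p assume p: "p \<in> ?N"
    show "p \<in> l"
    proof (rule ccontr)
      assume "p \<notin> l"
      then have "?c p \<le> (\<Sum>p\<in>?N - l. ?c p)"
        using p N by (intro member_le_sum) auto
      then have "?c p = 0" using on[OF l] split[of l] eq by simp
      moreover obtain s t where "s \<in> L" "t \<in> L" "s \<noteq> t" "p \<in> s" "p \<in> t"
        using p unfolding multiple_points_def by auto
      then have "{s, t} \<subseteq> {l\<in>L. p \<in> l}" "card {s, t} = 2" by auto
      then have "card {l\<in>L. p \<in> l} \<ge> 2"
        using fin card_mono[of "{l\<in>L. p \<in> l}" "{s, t}"] by simp
      ultimately show False by simp
    qed
  qed
  \<comment> \<open>A second line is needed so that there is a multiple point at all.\<close>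
  have "\<not> L \<subseteq> {l0}" using L2 card_mono[of "{l0}" L] by auto
  then obtain l1 where l1: "l1 \<in> L" "l1 \<noteq> l0" by blast
  then obtain p where "l0 \<inter> l1 = {p}" using meet[OF l0 l1(1)] by auto
  then have "p \<in> ?N" using l0 l1 unfolding multiple_points_def by blast
  then show "\<exists>p. \<forall>l\<in>L. p \<in> l" using sub by blast
qed

section \<open>Factorization of the Fermat forms\<close>

text \<open>The form \<open>Y^d f(X/Y)\<close>, faithful when \<open>degree f \<le> d\<close>. It
  transports a factorization in one variable to ternary polynomials.\<close>

definition homogenize :: "poly3 \<Rightarrow> poly3 \<Rightarrow> nat \<Rightarrow> complex poly \<Rightarrow> poly3" where
  "homogenize X Y d f = (\<Sum>k\<le>d. const3 (poly.coeff f k) * X ^ k * Y ^ (d - k))"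

lemma homogenize_add: "homogenize X Y d (f + g) = homogenize X Y d f + homogenize X Y d g"
  by (simp add: homogenize_def const3_add algebra_simps sum.distrib)

lemma homogenize_smult: "homogenize X Y d (smult c f) = const3 c * homogenize X Y d f"
  by (simp add: homogenize_def const3_mult sum_distrib_left mult.assoc)

lemma homogenize_pCons: "homogenize X Y (Suc d) (pCons 0 f) = X * homogenize X Y d f"
  unfolding homogenize_def sum.atMost_Suc_shift
  by (simp add: sum_distrib_left mult_ac)

lemma homogenize_Suc:
  assumes "degree f \<le> d"
  shows "homogenize X Y (Suc d) f = Y * homogenize X Y d f"
  using assms by (simp add: homogenize_def sum_distrib_left mult_ac coeff_eq_0 Suc_diff_le)

lemma homogenize_linear_mult:
  assumes "degree f \<le> d"
  shows "homogenize X Y (Suc d) ([:- z, 1:] * f) = (X - const3 z * Y) * homogenize X Y d f"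
proof -
  have "[:- z, 1:] * f = smult (- z) f + pCons 0 f" by simp
  then have "homogenize X Y (Suc d) ([:- z, 1:] * f) =
      const3 (- z) * (Y * homogenize X Y d f) + X * homogenize X Y d f"
    by (simp only: homogenize_add homogenize_smult homogenize_pCons homogenize_Suc[OF assms])
  then show ?thesis by (simp add: const3_uminus algebra_simps)
qed

lemma homogenize_prod_linear:
  assumes "finite S"
  shows "homogenize X Y (card S) (\<Prod>z\<in>S. [:- z, 1:]) = (\<Prod>z\<in>S. X - const3 z * Y)"
  using assms
proof (induction S rule: finite_induct)
  case empty
  then show ?case by (simp add: homogenize_def)
next
  case (insert z S)
  have "degree (\<Prod>z\<in>S. [:- z, 1:]) \<le> card S"
    using degree_prod_sum_le[OF insert.hyps(1), of "\<lambda>z. [:- z, 1:]"] by simp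
  from homogenize_linear_mult[OF this] show ?case
    using insert by simp
qed

text \<open>Both sides are monic of degree \<open>n\<close> and vanish at the \<open>n\<close> roots
  of unity, so their difference, of degree below \<open>n\<close>, is zero.\<close>

lemma prod_roots_of_unity:
  assumes "n > 0"
  shows "(\<Prod>z | z ^ n = 1. [:- z, 1:]) = monom 1 n - (1 :: complex poly)"
proof (rule poly_eqI_degree_lead_coeff[where n = n and A = "{z. z ^ n = 1}"])
  let ?U = "{z :: complex. z ^ n = 1}"
  have U: "finite ?U" "card ?U = n"
    using assms card_roots_unity_eq[of n] finite_roots_unity[of n] by auto
  have d: "degree (\<Prod>z\<in>?U. [:- z, 1:]) = n"
    using U by (subst degree_prod_eq_sum_degree) auto
  then show "degree (\<Prod>z\<in>?U. [:- z, 1:]) \<le> n" by simp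
  have "lead_coeff (\<Prod>z\<in>?U. [:- z, 1:]) = 1" by (simp add: lead_coeff_prod)
  then show "poly.coeff (\<Prod>z\<in>?U. [:- z, 1:]) n = poly.coeff (monom 1 n - 1) n"
    using d assms by simp
  show "degree (monom 1 n - (1 :: complex poly)) \<le> n"
    by (intro degree_diff_le) (simp_all add: degree_monom_le)
  show "n \<le> card ?U" using U by simp
  show "poly (\<Prod>z\<in>?U. [:- z, 1:]) w = poly (monom 1 n - 1) w" if "w \<in> ?U" for w
    using that U by (auto simp: poly_prod poly_monom prod_zero_iff)
qed

lemma power_diff_factorization:
  assumes "n > 0"
  shows "(\<Prod>z | z ^ n = 1. X - const3 z * Y) = X ^ n - Y ^ n"
proof -
  let ?U = "{z :: complex. z ^ n = 1}"
  have U: "finite ?U" "card ?U = n"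
    using assms card_roots_unity_eq[of n] finite_roots_unity[of n] by auto
  have "(\<Prod>z\<in>?U. X - const3 z * Y) = homogenize X Y n (monom 1 n - 1)"
    using homogenize_prod_linear[OF U(1), of X Y] U(2) prod_roots_of_unity[OF assms] by simp
  also have "monom 1 n - 1 = monom 1 n + smult (-1) ([:1:] :: complex poly)"
    by (simp only: smult_minus_left smult_1_left diff_conv_add_uminus one_pCons)
  also have "homogenize X Y n \<dots> = homogenize X Y n (monom 1 n) + const3 (-1) * homogenize X Y n [:1:]"
    by (simp only: homogenize_add homogenize_smult)
  also have "homogenize X Y n (monom 1 n) = X ^ n"
  proof -
    have "homogenize X Y n (monom 1 n) = (\<Sum>k\<le>n. if k = n then X ^ n else 0)"
      unfolding homogenize_def by (intro sum.cong) auto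
    then show ?thesis by simp
  qed
  also have "homogenize X Y n [:1:] = Y ^ n"
  proof -
    have "homogenize X Y n [:1:] = (\<Sum>k\<le>n. if k = 0 then Y ^ n else 0)"
      unfolding homogenize_def by (intro sum.cong) (auto simp: coeff_pCons split: nat.split)
    then show ?thesis by simp
  qed
  finally show ?thesis by (simp add: const3_uminus)
qed

lemma linear_form_fermat_vec:
  "linear_form (fermat_vec 0 z) = var3 1 - const3 z * var3 2"
  "linear_form (fermat_vec 1 z) = var3 1 - const3 z * var3 3"
  "linear_form (fermat_vec 2 z) = var3 2 - const3 z * var3 3"
  by (simp_all add: linear_form_def sum_3 fermat_vec_simps const3_uminus)

lemma fermat_factors_eq_prod:
  assumes "n > 0" "i < 3"
  shows "fermat_factors n i = (\<Prod>z | z ^ n = 1. linear_form (fermat_vec i z))"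
  using assms(2) unfolding less_3_cases
  by (elim disjE) (simp_all only: linear_form_fermat_vec power_diff_factorization[OF assms(1)],
      simp_all add: fermat_factors_def)

lemma defined_by_fermat:
  assumes "n > 0"
  shows "defined_by 3 (fermat_factors n)
    (\<lambda>i. (\<lambda>z. line_of (fermat_vec i z)) ` {z. z ^ n = 1}) (\<lambda>_. 1)"
  unfolding defined_by_def completely_reducible_def
proof (intro allI impI conjI)
  fix i :: nat assume i: "i < 3"
  let ?U = "{z :: complex. z ^ n = 1}" and ?g = "\<lambda>z. line_of (fermat_vec i z)"
  have inj: "inj ?g" by (rule inj_fermat_line[OF i])
  have "finite ?U" using assms finite_roots_unity[of n] by auto
  then show "finite (?g ` ?U)" by (rule finite_imageI)
  \<comment> \<open>\<open>completely_reducible\<close> indexes the linear forms by their lines, so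
    the form is recovered from the line by inverting the parametrization.\<close>
  let ?\<alpha> = "\<lambda>l. fermat_vec i (inv ?g l)"
  have "fermat_factors n i = (\<Prod>l\<in>?g ` ?U. linear_form (?\<alpha> l) ^ 1)"
    by (subst prod.reindex[OF inj_on_subset[OF inj]])
       (simp_all add: fermat_factors_eq_prod assms i inv_f_f[OF inj])
  then show "\<exists>\<alpha>. (\<forall>l\<in>?g ` ?U. \<alpha> l \<noteq> 0 \<and> line_of (\<alpha> l) = l \<and> (1 :: nat) > 0) \<and>
      fermat_factors n i = (\<Prod>l\<in>?g ` ?U. linear_form (\<alpha> l) ^ 1)"
    by (intro exI[of _ ?\<alpha>]) (auto simp: fermat_vec_nonzero i inv_f_f[OF inj])
qed

section \<open>Nets and completeness\<close>

text \<open>Intersecting lines of blocks \<open>i\<close> and \<open>j\<close> maps the pairs onto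
  the \<open>n\<^sup>2\<close> base points, while the degree allows at most \<open>n\<close> lines
  per block. Hence there are exactly \<open>n\<close> lines in each, all multiplicities are 1, and
  distinct pairs meet in distinct points.\<close>

lemma net_grid:
  assumes net: "net k n P B m" and n: "n \<ge> 2" and ij: "i < k" "j < k" "i \<noteq> j"
  shows "pencil_base P = {p. (\<exists>l\<in>B i. p \<in> l) \<and> (\<exists>l\<in>B j. p \<in> l)}"
    and "finite (B i)" "\<And>l. l \<in> B i \<Longrightarrow> is_line l" "B i \<inter> B j = {}"
    and "card (B i) = n" "\<And>l. l \<in> B i \<Longrightarrow> m l = 1"
    and "\<And>p l l'. p \<in> pencil_base P \<Longrightarrow> l \<in> B i \<Longrightarrow> l' \<in> B i \<Longrightarrow> p \<in> l \<Longrightarrow> p \<in> l' \<Longrightarrow> l = l'"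
proof -
  let ?X = "pencil_base P"
  have P: "pencil n P" and X: "card ?X = n\<^sup>2"
    using net unfolding net_def multinet_def by auto
  obtain Q where Q: "\<And>i. i < k \<Longrightarrow> Q i \<in> P" "\<And>i. i < k \<Longrightarrow> completely_reducible (Q i) (B i) m"
    and Qd: "\<And>i j. i < k \<Longrightarrow> j < k \<Longrightarrow> i \<noteq> j \<Longrightarrow> \<not> same_fiber (Q i) (Q j)"
    using net unfolding net_def multinet_def by blast
  note Bi = completely_reducibleD[OF Q(2)[OF ij(1)]] and Bj = completely_reducibleD[OF Q(2)[OF ij(2)]]
  show Xeq: "?X = {p. (\<exists>l\<in>B i. p \<in> l) \<and> (\<exists>l\<in>B j. p \<in> l)}"
    using pencil_base_eq[OF P Q(1)[OF ij(1)] Q(1)[OF ij(2)] Bi(4) Bj(4) Qd[OF ij]]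
    unfolding Bi(6) Bj(6) .
  show "finite (B i)" by (rule Bi(1))
  show "is_line l" if "l \<in> B i" for l using Bi(2)[OF that] .
  have finX: "finite ?X" using X n by (auto intro: card_ge_0_finite)
  show disj: "B i \<inter> B j = {}"
  proof (rule ccontr)
    assume "B i \<inter> B j \<noteq> {}"
    then obtain l where l: "l \<in> B i" "l \<in> B j" by blast
    \<comment> \<open>A common line would make the base infinite.\<close>
    then have "l \<subseteq> ?X" unfolding Xeq by blast
    then show False using finX line_infinite[OF Bi(2)[OF l(1)]] finite_subset by blast
  qed
  have deg: "sum m (B i) = n" if "i < k" for i
    using completely_reducibleD(4,5)[OF Q(2)[OF that]] pencil_homogeneous[OF P Q(1)[OF that]]
      homogeneous3_degree_unique by blast
  have card_le: "card (B i) \<le> n" if "i < k" for i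
  proof -
    have "(\<Sum>l\<in>B i. 1) \<le> sum m (B i)"
      using completely_reducibleD(3)[OF Q(2)[OF that]] by (intro sum_mono) (simp add: Suc_leI)
    then show ?thesis using deg[OF that] by simp
  qed
  define f where "f = (\<lambda>(l, l'). THE p :: cp2. l \<inter> l' = {p})"
  have f: "l \<inter> l' = {f (l, l')}" if ll: "l \<in> B i" "l' \<in> B j" for l l'
  proof -
    obtain p where "l \<inter> l' = {p}"
      using lines_meet[OF Bi(2)[OF ll(1)] Bj(2)[OF ll(2)]] ll disj by auto
    then show ?thesis by (simp add: f_def)
  qed
  have img: "?X = f ` (B i \<times> B j)"
  proof (intro equalityI subsetI)
    fix p assume "p \<in> ?X"
    then obtain l l' where l: "l \<in> B i" "l' \<in> B j" "p \<in> l \<inter> l'" unfolding Xeq by auto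
    then have "p = f (l, l')" using f[OF l(1,2)] by auto
    then show "p \<in> f ` (B i \<times> B j)" using l by blast
  next
    fix p assume "p \<in> f ` (B i \<times> B j)"
    then obtain l l' where l: "l \<in> B i" "l' \<in> B j" "p = f (l, l')" by auto
    then have "p \<in> l \<inter> l'" using f[OF l(1,2)] by auto
    then show "p \<in> ?X" unfolding Xeq using l by auto
  qed
  have finB: "finite (B i \<times> B j)" using Bi(1) Bj(1) by simp
  have "n * n \<le> card (B i) * card (B j)"
    using card_image_le[OF finB, of f] X by (simp add: img[symmetric] card_cartesian_product power2_eq_square)
  moreover have "card (B i) * card (B j) \<le> card (B i) * n" "card (B i) * card (B j) \<le> n * card (B j)"
    using card_le[OF ij(1)] card_le[OF ij(2)] by simp_all
  ultimately have "n * n \<le> card (B i) * n" "n * n \<le> n * card (B j)" by linarith+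
  then have c: "card (B i) = n" "card (B j) = n"
    using card_le[OF ij(1)] card_le[OF ij(2)] n by simp_all
  show "card (B i) = n" by (rule c)
  show "m l = 1" if l: "l \<in> B i" for l
  proof -
    \<comment> \<open>As each \<open>m l\<close> is at least 1, equal sums force equality in every
      term.\<close>
    have "(\<Sum>l\<in>B i. 1) = sum m (B i)" using deg[OF ij(1)] c by simp
    from sum_mono_inv[OF this _ l Bi(1)] show ?thesis using Bi(3) by (simp add: Suc_leI)
  qed
  have "card (f ` (B i \<times> B j)) = card (B i \<times> B j)"
    using X c by (simp add: img[symmetric] card_cartesian_product power2_eq_square)
  then have inj: "inj_on f (B i \<times> B j)" by (rule eq_card_imp_inj_on[OF finB])
  show "l = l'" if p: "p \<in> ?X" and l: "l \<in> B i" "l' \<in> B i" "p \<in> l" "p \<in> l'" for p l l'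
  proof -
    \<comment> \<open>Two lines of block \<open>i\<close> through \<open>p\<close>, paired with the
      same \<open>t\<close>, have the same intersection point, contradicting injectivity unless they
      agree.\<close>
    obtain t where t: "t \<in> B j" "p \<in> t" using p unfolding Xeq by blast
    have "p = f (l, t)" "p = f (l', t)" using f[OF l(1) t(1)] f[OF l(2) t(1)] l t by auto
    then have "f (l, t) = f (l', t)" by simp
    from inj_onD[OF inj this] show ?thesis using l t by simp
  qed
qed

lemma net_block:
  assumes net: "net k n P B m" and n: "n \<ge> 2" and i: "i < k"
  shows "finite (B i)" "card (B i) = n" "\<And>l. l \<in> B i \<Longrightarrow> is_line l" "\<And>l. l \<in> B i \<Longrightarrow> m l = 1"
    and "\<And>p l l'. p \<in> pencil_base P \<Longrightarrow> l \<in> B i \<Longrightarrow> l' \<in> B i \<Longrightarrow> p \<in> l \<Longrightarrow> p \<in> l' \<Longrightarrow> l = l'"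
proof -
  have "k \<ge> 3" using net unfolding net_def multinet_def by blast
  then obtain j where j: "j < k" "i \<noteq> j"
    by (intro that[of "if i = 0 then 1 else 0"]) auto
  note grid = net_grid[OF net n i j]
  show "finite (B i)" by (rule grid(2))
  show "card (B i) = n" by (rule grid(5))
  show "\<And>l. l \<in> B i \<Longrightarrow> is_line l" by (rule grid(3))
  show "\<And>l. l \<in> B i \<Longrightarrow> m l = 1" by (rule grid(6))
  show "\<And>p l l'. p \<in> pencil_base P \<Longrightarrow> l \<in> B i \<Longrightarrow> l' \<in> B i \<Longrightarrow> p \<in> l \<Longrightarrow> p \<in> l' \<Longrightarrow> l = l'"
    by (rule grid(7))
qed

text \<open>Lines of different blocks meet only in the base, and lines of one block only outside it.
  So the sum in the completeness condition splits into one sum per block.\<close>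

lemma nonbase_points_net:
  assumes net: "net 3 n P B m" and n: "n \<ge> 2"
  shows "nonbase_points 3 P B = (\<Union>i<3. multiple_points (B i))"
    and "\<And>i j. i < 3 \<Longrightarrow> j < 3 \<Longrightarrow> i \<noteq> j \<Longrightarrow> multiple_points (B i) \<inter> multiple_points (B j) = {}"
    and "\<And>i p. i < 3 \<Longrightarrow> p \<in> multiple_points (B i) \<Longrightarrow> line_count 3 B p = card {l \<in> B i. p \<in> l}"
proof -
  note grid = net_grid[OF net n]
  have nb: "p \<notin> pencil_base P" if i: "i < 3" and p: "p \<in> multiple_points (B i)" for i p
  proof
    assume X: "p \<in> pencil_base P"
    obtain l l' where l: "l \<in> B i" "l' \<in> B i" "l \<noteq> l'" "p \<in> l" "p \<in> l'"
      using p unfolding multiple_points_def by blast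
    then show False using net_block(5)[OF net n i X l(1,2,4,5)] by simp
  qed
  have same: "i = j" if ij: "i < 3" "j < 3" and p: "p \<notin> pencil_base P" "l \<in> B i" "l' \<in> B j" "p \<in> l" "p \<in> l'"
    for i j p l l'
  proof (rule ccontr)
    assume "i \<noteq> j"
    then show False using grid(1)[OF ij] p by blast
  qed
  show "nonbase_points 3 P B = (\<Union>i<3. multiple_points (B i))"
  proof (intro equalityI subsetI)
    fix p assume "p \<in> nonbase_points 3 P B"
    then obtain i j l l' where *: "i < 3" "j < 3" "l \<in> B i" "l' \<in> B j" "l \<noteq> l'" "p \<in> l" "p \<in> l'"
      "p \<notin> pencil_base P"
      unfolding nonbase_points_def all_lines_def by blast
    then have "i = j" using same by blast
    then have "p \<in> multiple_points (B i)" unfolding multiple_points_def using * by blast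
    then show "p \<in> (\<Union>i<3. multiple_points (B i))" using *(1) by blast
  next
    fix p assume "p \<in> (\<Union>i<3. multiple_points (B i))"
    then obtain i where i: "i < 3" "p \<in> multiple_points (B i)" by blast
    then obtain l l' where "l \<in> B i" "l' \<in> B i" "l \<noteq> l'" "p \<in> l \<inter> l'"
      unfolding multiple_points_def by blast
    then show "p \<in> nonbase_points 3 P B"
      unfolding nonbase_points_def all_lines_def using i nb[OF i] by blast
  qed
  show "multiple_points (B i) \<inter> multiple_points (B j) = {}" if ij: "i < 3" "j < 3" "i \<noteq> j" for i j
  proof (rule ccontr)
    assume "multiple_points (B i) \<inter> multiple_points (B j) \<noteq> {}"
    then obtain p where p: "p \<in> multiple_points (B i)" "p \<in> multiple_points (B j)" by blast
    obtain l where l: "l \<in> B i" "p \<in> l" using p(1) unfolding multiple_points_def by blast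
    obtain l' where l': "l' \<in> B j" "p \<in> l'" using p(2) unfolding multiple_points_def by blast
    show False using same[OF ij(1,2) nb[OF ij(1) p(1)] l(1) l'(1) l(2) l'(2)] ij(3) by simp
  qed
  show "line_count 3 B p = card {l \<in> B i. p \<in> l}" if i: "i < 3" and p: "p \<in> multiple_points (B i)" for i p
  proof -
    obtain l where l: "l \<in> B i" "p \<in> l" using p unfolding multiple_points_def by blast
    have "l' \<in> B i" if l': "l' \<in> B j" "j < 3" "p \<in> l'" for l' j
      using same[OF i l'(2) nb[OF i p] l(1) l'(1) l(2) l'(3)] l' by simp
    then have "{l \<in> all_lines 3 B. p \<in> l} = {l \<in> B i. p \<in> l}"
      using i unfolding all_lines_def by blast
    then show ?thesis by (simp add: line_count_def)
  qed
qed

text \<open>With \<open>k = 3\<close>, all base multiplicities 1, \<open>n\<^sup>2\<close> base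
  points and \<open>3 * n\<close> lines, completeness reads
  \<open>S 0 + S 1 + S 2 + 3 = 3 * n\<close>. Each \<open>S i\<close> is at least
  \<open>n - 1\<close>, so all three bounds are attained.\<close>

lemma complete_net_concurrent:
  assumes n: "n \<ge> 2" and net: "net 3 n P B m" and complete: "complete_multinet 3 n P B m" and i: "i < 3"
  shows "\<exists>p. \<forall>l\<in>B i. p \<in> l"
proof -
  note grid = net_grid[OF net n] and nonbase = nonbase_points_net[OF net n]
  note fin = net_block(1,2)[OF net n] and line = net_block(3)[OF net n]
  have meet: "\<exists>p. l \<inter> l' = {p}" if "i < 3" "l \<in> B i" "l' \<in> B i" "l \<noteq> l'" for i l l'
    using lines_meet[OF line[OF that(1,2)] line[OF that(1,3)] that(4)] .
  have bound: "finite (multiple_points (B i))"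
    "n - 1 \<le> (\<Sum>p\<in>multiple_points (B i). card {l\<in>B i. p \<in> l} - 1)"
    "(\<Sum>p\<in>multiple_points (B i). card {l\<in>B i. p \<in> l} - 1) = n - 1 \<Longrightarrow> \<exists>p. \<forall>l\<in>B i. p \<in> l"
    if i: "i < 3" for i
  proof -
    have "card (B i) \<ge> 2" using fin(2)[OF i] n by simp
    note b = multiple_points_bound[OF fin(1)[OF i] meet[OF i] this, unfolded fin(2)[OF i]]
    show "finite (multiple_points (B i))" by (rule b(1))
    show "n - 1 \<le> (\<Sum>p\<in>multiple_points (B i). card {l\<in>B i. p \<in> l} - 1)" by (rule b(2))
    show "(\<Sum>p\<in>multiple_points (B i). card {l\<in>B i. p \<in> l} - 1) = n - 1 \<Longrightarrow> \<exists>p. \<forall>l\<in>B i. p \<in> l"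
      by (rule b(3))
  qed
  define S where "S i = (\<Sum>p\<in>multiple_points (B i). card {l\<in>B i. p \<in> l} - 1)" for i
  have mult1: "base_mult B m p = 1" if p: "p \<in> pencil_base P" for p
  proof -
    have 01: "(0::nat) < 3" "(1::nat) < 3" "(0::nat) \<noteq> 1" by simp_all
    obtain l where l: "l \<in> B 0" "p \<in> l" using p grid(1)[OF 01] by blast
    have "{l. l \<in> B 0 \<and> p \<in> l} = {l}" using grid(7)[OF 01 p] l by blast
    then show ?thesis using grid(6)[OF 01 l(1)] by (simp add: base_mult_def)
  qed
  have X: "card (pencil_base P) = n\<^sup>2" using net unfolding net_def by simp
  have "card (\<Union>i\<in>{..<3}. B i) = (\<Sum>i\<in>{..<3}. card (B i))"
    using fin(1) grid(4) by (intro card_UN_disjoint) auto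
  also have "\<dots> = (\<Sum>i\<in>{..<3::nat}. n)" using fin(2) by (intro sum.cong) auto
  finally have lines: "card (all_lines 3 B) = 3 * n" by (simp add: all_lines_def)
  have "(\<Sum>p\<in>nonbase_points 3 P B. int (line_count 3 B p) - 1) =
      (\<Sum>i\<in>{..<3}. \<Sum>p\<in>multiple_points (B i). int (line_count 3 B p) - 1)"
    unfolding nonbase(1) using bound(1) nonbase(2) by (intro sum.UNION_disjoint) auto
  also have "\<dots> = (\<Sum>i\<in>{..<3}. int (S i))"
  proof (rule sum.cong)
    fix i :: nat assume "i \<in> {..<3}"
    then have i: "i < 3" by simp
    have "int (line_count 3 B p) - 1 = int (card {l\<in>B i. p \<in> l} - 1)" if p: "p \<in> multiple_points (B i)" for p
    proof -
      \<comment> \<open>Positivity of the count makes truncated subtraction on \<open>nat\<close>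
        agree with subtraction on \<open>int\<close>.\<close>
      have "{l\<in>B i. p \<in> l} \<noteq> {}" using p unfolding multiple_points_def by blast
      then have "card {l\<in>B i. p \<in> l} > 0" using fin(1)[OF i] by (simp add: card_gt_0_iff)
      then show ?thesis using nonbase(3)[OF i p] by simp
    qed
    then show "(\<Sum>p\<in>multiple_points (B i). int (line_count 3 B p) - 1) = int (S i)"
      unfolding S_def of_nat_sum by (intro sum.cong) simp_all
  qed simp
  also have "\<dots> = int (S 0) + int (S 1) + int (S 2)"
    by (simp add: numeral_3_eq_3 numeral_2_eq_2 lessThan_Suc)
  finally have nonbase_sum: "(\<Sum>p\<in>nonbase_points 3 P B. int (line_count 3 B p) - 1) =
      int (S 0) + int (S 1) + int (S 2)" .
  have "3 + int (card (pencil_base P)) =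
       (2 - int 3) * (3 * int n - (int n)\<^sup>2 +
          (\<Sum>p\<in>pencil_base P. (int (base_mult B m p))\<^sup>2 - int (base_mult B m p)))
       + 2 * int (card (all_lines 3 B))
       - (\<Sum>p\<in>nonbase_points 3 P B. int (line_count 3 B p) - 1)"
    using complete unfolding complete_multinet_def by blast
  moreover have "(\<Sum>p\<in>pencil_base P. (int (base_mult B m p))\<^sup>2 - int (base_mult B m p)) = 0"
    by (intro sum.neutral) (simp add: mult1)
  ultimately have total: "S 0 + S 1 + S 2 + 3 = 3 * n"
    unfolding nonbase_sum lines X by simp
  have "n - 1 \<le> S 0" "n - 1 \<le> S 1" "n - 1 \<le> S 2"
    unfolding S_def by (rule bound(2), simp)+
  then have "S 0 = n - 1 \<and> S 1 = n - 1 \<and> S 2 = n - 1" using total n by linarith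
  then have "S i = n - 1" using i unfolding less_3_cases by (elim disjE) (simp_all only:)
  then show ?thesis using bound(3)[OF i] unfolding S_def by blast
qed

lemma complete_net_concurrent_blocks:
  assumes n: "n \<ge> 2" and net: "net 3 n P B m" and complete: "complete_multinet 3 n P B m"
  shows "\<exists>p. concurrent_net n B p"
proof -
  note grid = net_grid[OF net n]
  note fin = net_block(1,2)[OF net n] and line = net_block(3)[OF net n]
  have "\<forall>i. \<exists>q. i < 3 \<longrightarrow> (\<forall>l\<in>B i. q \<in> l)"
    using complete_net_concurrent[OF n net complete] by blast
  then obtain p where "\<forall>i. i < 3 \<longrightarrow> (\<forall>l\<in>B i. p i \<in> l)" by (rule choice[THEN exE])
  then have p: "\<And>i l. i < 3 \<Longrightarrow> l \<in> B i \<Longrightarrow> p i \<in> l" by blast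
  have apart: "p j \<notin> l" if ij: "i < 3" "j < 3" "i \<noteq> j" and l: "l \<in> B i" for i j l
  \<comment> \<open>If the centre of block \<open>j\<close> lay on a line of block \<open>i\<close>,
    it would be a base point on at least two lines of block \<open>j\<close>.\<close>
  proof
    assume pj: "p j \<in> l"
    have "\<exists>s\<in>B j. \<exists>t\<in>B j. s \<noteq> t"
      using card_le_Suc0_iff_eq[OF fin(1)[OF ij(2)]] fin(2)[OF ij(2)] n by auto
    then obtain s t where st: "s \<in> B j" "t \<in> B j" "s \<noteq> t" by blast
    have "p j \<in> pencil_base P"
      unfolding grid(1)[OF ij] using pj l p[OF ij(2) st(1)] st(1) by blast
    from net_block(5)[OF net n ij(2) this st(1,2) p[OF ij(2) st(1)] p[OF ij(2) st(2)]]
    show False using st(3) by simp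
  qed
  have third: "\<exists>l''\<in>B 2. l \<inter> l' \<inter> l'' \<noteq> {}" if l: "l \<in> B 0" "l' \<in> B 1" for l l'
  proof -
    have idx: "(0::nat) < 3" "(1::nat) < 3" "(2::nat) < 3" "(0::nat) \<noteq> 1" "(0::nat) \<noteq> 2" by simp_all
    have "l \<noteq> l'" using grid(4)[OF idx(1,2,4)] l by blast
    then obtain q where q: "l \<inter> l' = {q}"
      using lines_meet[OF line[OF idx(1) l(1)] line[OF idx(2) l(2)]] by blast
    \<comment> \<open>The base is the same for every pair of blocks: the pair \<open>0\<close>,
      \<open>1\<close> puts \<open>q\<close> into it, and the pair \<open>0\<close>,
      \<open>2\<close> yields the third line.\<close>
    then have "q \<in> pencil_base P" unfolding grid(1)[OF idx(1,2,4)] using l by blast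
    then obtain l'' where "l'' \<in> B 2" "q \<in> l''" unfolding grid(1)[OF idx(1,3,5)] by blast
    then show ?thesis using q by blast
  qed
  show ?thesis
    unfolding concurrent_net_def using fin line p apart third by (intro exI[of _ p] conjI allI impI ballI) simp_all
qed

theorem theorem4p4:
  fixes n :: nat and P :: "poly3 set"
    and B :: "nat \<Rightarrow> cp2 set set" and m :: "cp2 set \<Rightarrow> nat"
  assumes "n \<ge> 2"
    and "net 3 n P B m"
    and "complete_multinet 3 n P B m"
  shows "\<exists>B' m'. defined_by 3 (fermat_factors n) B' m' \<and> proj_equivalent 3 B m B' m'"
proof -
  let ?B' = "\<lambda>i. (\<lambda>z. line_of (fermat_vec i z)) ` {z. z ^ n = 1}"
  obtain p where "concurrent_net n B p"
    using complete_net_concurrent_blocks[OF assms] by blast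
  then obtain T where T: "invertible T" "\<And>i. i < 3 \<Longrightarrow> (`) (proj_map T) ` B i = ?B' i"
    using concurrent_net_fermat assms(1) by blast
  have "proj_equivalent 3 B m ?B' (\<lambda>_. 1)"
    unfolding proj_equivalent_def
    by (rule exI[of _ T], rule conjI[OF T(1)], rule exI[of _ id]) (simp add: T(2) net_block(4)[OF assms(2,1)])
  moreover have "defined_by 3 (fermat_factors n) ?B' (\<lambda>_. 1)"
    using defined_by_fermat[of n] assms(1) by simp
  ultimately show ?thesis by blast
qed

end
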